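(* Let $w\colon \mathbb{N}\rightarrow \mathbb{R}$ be a nonnegative function. The $w$-energy form $(\mathcal{E}_w,\mathsf{D}_w)$ has the contraction property, namely, for every contraction function $C\colon \mathbb{R}\rightarrow \mathbb{R}$ and every $\xi\in \mathsf{D}_w$, it holds that $C\circ\xi\in \mathsf{D}_w$ and $$\mathcal{E}_w(C\circ\xi,C\circ\xi) \leq \mathcal{E}_w(\xi,\xi).$$
   Context: $\mathbb{N}$ denotes the set of nonnegative integers and $\Gamma$ the set of all finite subsets of $\mathbb{N}$ (including $\emptyset$). Let $\Omega=\{-1,1\}^{\mathbb{N}}$, let $\zeta_n(\omega)=\omega(n)$ ($n\geq 0$) be the canonical projections, and let $\mathscr{F}$ be the $\sigma$-field on $\Omega$ generated by $(\zeta_n)_{n\geq 0}$. Let $(p_n)_{n\geq 0}$ be a given sequence with $0<p_n<1$ for all $n$, and put $q_n=1-p_n$. Let $\mathbb{P}$ be the unique probability measure on $\mathscr{F}$ under which the $\zeta_n$ are independent with $\mathbb{P}\{\zeta_n=1\}=p_n$, $\mathbb{P}\{\zeta_n=-1\}=q_n$. Set $Z_n = \dfrac{\zeta_n+q_n-p_n}{2\sqrt{p_nq_n}}$, $Z_\emptyset=1$, and $Z_\sigma=\prod_{j\in\sigma}Z_j$ for nonempty $\sigma\in\Gamma$. $L^2(\Omega)=L^2(\Omega,\mathscr{F},\mathbb{P})$ is the real Hilbert space of square integrable random variables, with inner product $\langle\cdot,\cdot\rangle$ and norm $\|\cdot\|$. It is known that $\{Z_\sigma\mid\sigma\in\Gamma\}$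 is an orthonormal basis of $L^2(\Omega)$. For $k\in\mathbb{N}$, the annihilation operator $\partial_k$ is the (unique) bounded linear operator on $L^2(\Omega)$ with $\partial_kZ_\sigma=\mathbf{1}_\sigma(k)Z_{\sigma\setminus\{k\}}$ for all $\sigma\in\Gamma$, where $\mathbf{1}_\sigma$ is the indicator of $\sigma\subset\mathbb{N}$. For a nonnegative function $w\colon\mathbb{N}\to\mathbb{R}$, $\#_w(\sigma)=\sum_{j\in\sigma}w(j)$ for $\sigma\in\Gamma$, with $\#_w(\emptyset)=0$. Put $\mathsf{D}_w=\{\xi\in L^2(\Omega)\mid\sum_{\sigma\in\Gamma}\#_w(\sigma)|\langle Z_\sigma,\xi\rangle|^2<\infty\}$, a linear subspace of $L^2(\Omega)$. The $w$-energy form is $(\mathcal{E}_w,\mathsf{D}_w)$, where $$\mathcal{E}_w(\xi,\eta)=\sum_{k=0}^\infty w(k)\langle\partial_k\xi,\partial_k\eta\rangle,\quad \xi,\eta\in\mathsf{D}_w$$ (the series converges absolutely). A contraction function is a function $C\colon\mathbb{R}\to\mathbb{R}$ with $C(0)=0$ and $|C(s)-C(t)|\leq|s-t|$ for all $s,t\in\mathbb{R}$. $C\circ\xi$ denotes the composition of $C$ with the random variable $\xi$. *)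

theory Defs
  imports "HOL-Probability.Probability"
begin

text \<open>
  The underlying set of this measure space is \<open>{-1,1}\<^sup>\<nat>\<close>, its \<open>\<sigma>\<close>-field is generated by the
  coordinate projections, and under it the coordinates are independent with
  \<open>\<P>(\<zeta>\<^sub>n = 1) = p\<^sub>n\<close> and \<open>\<P>(\<zeta>\<^sub>n = -1) = 1 - p\<^sub>n\<close>; see \<open>space_coin_space\<close>,
  \<open>sets_coin_space\<close>, \<open>indep_vars_coin_space\<close> and \<open>prob_coin_space_coordinate\<close> below.
\<close>

definition coin :: "real \<Rightarrow> real measure" where
  "coin p = point_measure {-1, 1} (\<lambda>x. if x = 1 then ennreal p else ennreal (1 - p))"

definition coin_space :: "(nat \<Rightarrow> real) \<Rightarrow> (nat \<Rightarrow> real) measure" where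
  "coin_space p = (\<Pi>\<^sub>M n\<in>UNIV. coin (p n))"

definition Z :: "(nat \<Rightarrow> real) \<Rightarrow> nat set \<Rightarrow> (nat \<Rightarrow> real) \<Rightarrow> real" where
  "Z p \<sigma> \<omega> = (\<Prod>j\<in>\<sigma>. (\<omega> j + (1 - p j) - p j) / (2 * sqrt (p j * (1 - p j))))"

text \<open>
  Elements of \<open>L\<^sup>2\<close> are represented by square integrable functions; equality in \<open>L\<^sup>2\<close> is
  almost sure equality, and operators on \<open>L\<^sup>2\<close> are represented by maps on representatives.
\<close>

definition L2 :: "'a measure \<Rightarrow> ('a \<Rightarrow> real) set" where
  "L2 M = {f \<in> borel_measurable M. integrable M (\<lambda>x. (f x)\<^sup>2)}"

definition L2_inner :: "'a measure \<Rightarrow> ('a \<Rightarrow> real) \<Rightarrow> ('a \<Rightarrow> real) \<Rightarrow> real" where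
  "L2_inner M f g = (\<integral>x. f x * g x \<partial>M)"

definition L2_norm :: "'a measure \<Rightarrow> ('a \<Rightarrow> real) \<Rightarrow> real" where
  "L2_norm M f = sqrt (L2_inner M f f)"

text \<open>
  Linearity and boundedness make such a map compatible with almost sure equality
  (\<open>bounded_linear_L2_cong\<close> below), so it descends to \<open>L\<^sup>2\<close>.
\<close>

definition bounded_linear_L2 :: "'a measure \<Rightarrow> (('a \<Rightarrow> real) \<Rightarrow> ('a \<Rightarrow> real)) \<Rightarrow> bool" where
  "bounded_linear_L2 M T \<longleftrightarrow>
     (\<forall>f\<in>L2 M. T f \<in> L2 M) \<and>
     (\<forall>f\<in>L2 M. \<forall>g\<in>L2 M. \<forall>a b. AE x in M. T (\<lambda>y. a * f y + b * g y) x = a * T f x + b * T g x) \<and>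
     (\<exists>B. \<forall>f\<in>L2 M. L2_norm M (T f) \<le> B * L2_norm M f)"

definition is_annihilation ::
    "(nat \<Rightarrow> real) \<Rightarrow> nat \<Rightarrow> (((nat \<Rightarrow> real) \<Rightarrow> real) \<Rightarrow> ((nat \<Rightarrow> real) \<Rightarrow> real)) \<Rightarrow> bool" where
  "is_annihilation p k T \<longleftrightarrow>
     bounded_linear_L2 (coin_space p) T \<and>
     (\<forall>\<sigma>. finite \<sigma> \<longrightarrow>
       (AE \<omega> in coin_space p. T (Z p \<sigma>) \<omega> = indicator \<sigma> k * Z p (\<sigma> - {k}) \<omega>))"

text \<open>
  The operator is unique only up to the choice of representatives, hence the use of \<open>SOME\<close>;
  existence is \<open>ex_is_annihilation\<close> below.
\<close>

definition annihilation ::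
    "(nat \<Rightarrow> real) \<Rightarrow> nat \<Rightarrow> ((nat \<Rightarrow> real) \<Rightarrow> real) \<Rightarrow> ((nat \<Rightarrow> real) \<Rightarrow> real)" where
  "annihilation p k = (SOME T. is_annihilation p k T)"

definition weight_count :: "(nat \<Rightarrow> real) \<Rightarrow> nat set \<Rightarrow> real" where
  "weight_count w \<sigma> = (\<Sum>j\<in>\<sigma>. w j)"

definition energy_domain :: "(nat \<Rightarrow> real) \<Rightarrow> (nat \<Rightarrow> real) \<Rightarrow> ((nat \<Rightarrow> real) \<Rightarrow> real) set" where
  "energy_domain p w = {\<xi> \<in> L2 (coin_space p).
     (\<lambda>\<sigma>. weight_count w \<sigma> * \<bar>L2_inner (coin_space p) (Z p \<sigma>) \<xi>\<bar>\<^sup>2) summable_on {\<sigma>. finite \<sigma>}}"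

definition energy_form ::
    "(nat \<Rightarrow> real) \<Rightarrow> (nat \<Rightarrow> real) \<Rightarrow> ((nat \<Rightarrow> real) \<Rightarrow> real) \<Rightarrow> ((nat \<Rightarrow> real) \<Rightarrow> real) \<Rightarrow> real" where
  "energy_form p w \<xi> \<eta> =
     (\<Sum>k. w k * L2_inner (coin_space p) (annihilation p k \<xi>) (annihilation p k \<eta>))"

definition contraction_function :: "(real \<Rightarrow> real) \<Rightarrow> bool" where
  "contraction_function C \<longleftrightarrow> C 0 = 0 \<and> (\<forall>s t. \<bar>C s - C t\<bar> \<le> \<bar>s - t\<bar>)"

lemma space_coin [simp]: "space (coin a) = {-1, 1}"
  and sets_coin [simp]: "sets (coin a) = Pow {-1, 1}"
  by (simp_all add: coin_def space_point_measure sets_point_measure)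

lemma prob_space_coin:
  assumes "0 < a" "a < 1"
  shows "prob_space (coin a)"
proof
  show "emeasure (coin a) (space (coin a)) = 1"
    using assms unfolding space_coin
    by (simp add: coin_def emeasure_point_measure_finite flip: ennreal_plus)
qed

lemma space_coin_space: "space (coin_space p) = {\<omega>. \<forall>n. \<omega> n \<in> {-1, 1}}"
  by (auto simp: coin_space_def space_PiM PiE_UNIV_domain)

lemma sets_coin_space:
  "sets (coin_space p) = sigma_sets {\<omega>. \<forall>n. \<omega> n \<in> {-1, 1}}
     {{\<omega>. (\<forall>n. \<omega> n \<in> {-1, 1}) \<and> \<omega> n \<in> A} | n A. A \<subseteq> {-1, 1}}"
proof -
  have "(\<Pi>\<^sub>E i\<in>(UNIV::nat set). {-1, 1::real}) = {\<omega>. \<forall>n. \<omega> n \<in> {-1, 1}}"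
    by (simp only: PiE_UNIV_domain) auto
  then show ?thesis
    unfolding coin_space_def sets_PiM_single
    by (intro arg_cong2[where f=sigma_sets]) (auto simp: PiE_UNIV_domain)
qed

lemma prob_space_coin_space:
  assumes "\<And>n. 0 < p n \<and> p n < 1"
  shows "prob_space (coin_space p)"
  unfolding coin_space_def using assms by (intro prob_space_PiM prob_space_coin) auto

lemma prob_coin_space_coordinate:
  assumes "\<And>n. 0 < p n \<and> p n < 1"
  shows "measure (coin_space p) {\<omega> \<in> space (coin_space p). \<omega> n = 1} = p n"
    and "measure (coin_space p) {\<omega> \<in> space (coin_space p). \<omega> n = -1} = 1 - p n"
proof -
  have pr: "\<And>n. prob_space (coin (p n))"
    using assms by (intro prob_space_coin) auto
  have *: "measure (coin_space p) {\<omega> \<in> space (coin_space p). \<omega> n = c} = measure (coin (p n)) {c}"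
    if "c \<in> {-1, 1}" for c
  proof -
    have "distr (coin_space p) (coin (p n)) (\<lambda>\<omega>. \<omega> n) = coin (p n)"
      unfolding coin_space_def using pr by (intro distr_PiM_component) auto
    then have "measure (coin (p n)) {c} =
        measure (distr (coin_space p) (coin (p n)) (\<lambda>\<omega>. \<omega> n)) {c}" by simp
    also have "\<dots> = measure (coin_space p) ((\<lambda>\<omega>. \<omega> n) -` {c} \<inter> space (coin_space p))"
      using that by (intro measure_distr) (auto simp: coin_space_def)
    also have "(\<lambda>\<omega>. \<omega> n) -` {c} \<inter> space (coin_space p) = {\<omega> \<in> space (coin_space p). \<omega> n = c}"
      by auto
    finally show ?thesis by simp
  qed
  have "measure (coin (p n)) {1} = p n" "measure (coin (p n)) {-1} = 1 - p n"
    using assms[of n] by (simp_all add: coin_def emeasure_point_measure_finite Sigma_Algebra.measure_def)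
  then show "measure (coin_space p) {\<omega> \<in> space (coin_space p). \<omega> n = 1} = p n"
    and "measure (coin_space p) {\<omega> \<in> space (coin_space p). \<omega> n = -1} = 1 - p n"
    by (simp_all add: *)
qed

lemma indep_vars_coin_space:
  assumes "\<And>n. 0 < p n \<and> p n < 1"
  shows "prob_space.indep_vars (coin_space p) (\<lambda>n. coin (p n)) (\<lambda>n \<omega>. \<omega> n) UNIV"
proof -
  interpret prob_space "coin_space p" using assms by (rule prob_space_coin_space)
  have pr: "\<And>n. prob_space (coin (p n))"
    using assms by (intro prob_space_coin) auto
  have d: "distr (coin_space p) (coin (p n)) (\<lambda>\<omega>. \<omega> n) = coin (p n)" for n
    unfolding coin_space_def using pr by (intro distr_PiM_component) auto
  show ?thesis
    by (subst indep_vars_iff_distr_eq_PiM')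
      (simp add: coin_space_def, simp add: coin_space_def, simp add: d coin_space_def[symmetric] restrict_UNIV distr_id)
qed

lemma L2_lincomb:
  assumes "f \<in> L2 M" "g \<in> L2 M"
  shows "(\<lambda>x. a * f x + b * g x) \<in> L2 M"
proof -
  have [measurable]: "f \<in> borel_measurable M" "g \<in> borel_measurable M"
    using assms by (auto simp: L2_def)
  have i: "integrable M (\<lambda>x. 2 * a\<^sup>2 * (f x)\<^sup>2 + 2 * b\<^sup>2 * (g x)\<^sup>2)"
    using assms by (auto simp: L2_def)
  have "integrable M (\<lambda>x. (a * f x + b * g x)\<^sup>2)"
  proof (rule Bochner_Integration.integrable_bound[OF i], measurable, rule AE_I2)
    fix x
    have "(a * f x + b * g x)\<^sup>2 + (a * f x - b * g x)\<^sup>2 = 2 * a\<^sup>2 * (f x)\<^sup>2 + 2 * b\<^sup>2 * (g x)\<^sup>2"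
      by algebra
    moreover have "0 \<le> (a * f x - b * g x)\<^sup>2" by simp
    ultimately have "(a * f x + b * g x)\<^sup>2 \<le> 2 * a\<^sup>2 * (f x)\<^sup>2 + 2 * b\<^sup>2 * (g x)\<^sup>2" by linarith
    then show "norm ((a * f x + b * g x)\<^sup>2) \<le> norm (2 * a\<^sup>2 * (f x)\<^sup>2 + 2 * b\<^sup>2 * (g x)\<^sup>2)" by simp
  qed
  then show ?thesis by (simp add: L2_def)
qed

lemma bounded_linear_L2_cong:
  assumes T: "bounded_linear_L2 M T" and f: "f \<in> L2 M" and g: "g \<in> L2 M"
    and eq: "AE x in M. f x = g x"
  shows "AE x in M. T f x = T g x"
proof -
  define h where "h = (\<lambda>y. 1 * f y + (-1) * g y)"
  have h: "h \<in> L2 M" unfolding h_def by (intro L2_lincomb f g)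
  have Th: "T h \<in> L2 M" using T h by (auto simp: bounded_linear_L2_def)
  have "AE x in M. h x * h x = 0" using eq by (auto simp: h_def)
  then have "L2_norm M h = 0"
    unfolding L2_norm_def L2_inner_def by (simp add: integral_eq_zero_AE)
  moreover obtain B where "\<forall>f\<in>L2 M. L2_norm M (T f) \<le> B * L2_norm M f"
    using T unfolding bounded_linear_L2_def by blast
  ultimately have "L2_norm M (T h) \<le> 0" using h by fastforce
  then have "(\<integral>x. (T h x)\<^sup>2 \<partial>M) \<le> 0"
    by (simp add: L2_norm_def L2_inner_def power2_eq_square)
  moreover have "0 \<le> (\<integral>x. (T h x)\<^sup>2 \<partial>M)" by (intro integral_nonneg_AE) simp
  moreover have "integrable M (\<lambda>x. (T h x)\<^sup>2)" using Th by (simp add: L2_def)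
  ultimately have "AE x in M. (T h x)\<^sup>2 = 0"
    using integral_nonneg_eq_0_iff_AE[of M "\<lambda>x. (T h x)\<^sup>2"] by auto
  moreover have "AE x in M. T h x = 1 * T f x + (-1) * T g x"
    using T f g unfolding bounded_linear_L2_def h_def by blast
  ultimately show ?thesis by eventually_elim simp
qed

lemma nn_integral_coin_space_upd:
  assumes p: "\<And>n. 0 < p n \<and> p n < 1" and [measurable]: "g \<in> borel_measurable (coin_space p)"
  shows "(\<integral>\<^sup>+\<omega>. g \<omega> \<partial>coin_space p) =
    ennreal (p k) * (\<integral>\<^sup>+\<omega>. g (\<omega> (k := 1)) \<partial>coin_space p) +
    ennreal (1 - p k) * (\<integral>\<^sup>+\<omega>. g (\<omega> (k := -1)) \<partial>coin_space p)"
proof -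
  let ?M = "coin_space p"
  have pr: "\<And>n. prob_space (coin (p n))" using p by (intro prob_space_coin) auto
  interpret C: prob_space "coin (p k)" by (rule pr)
  interpret P: prob_space ?M using p by (rule prob_space_coin_space)
  have m: "(\<lambda>(x, X). X(k := x)) \<in> measurable (coin (p k) \<Otimes>\<^sub>M ?M) ?M"
    unfolding coin_space_def
  proof (rule measurable_PiM_single')
    fix i :: nat
    show "(\<lambda>\<omega>. (case \<omega> of (x, X) \<Rightarrow> X(k := x)) i) \<in>
        measurable (coin (p k) \<Otimes>\<^sub>M (\<Pi>\<^sub>M n\<in>UNIV. coin (p n))) (coin (p i))"
      by (cases "i = k") (simp_all add: split_beta')
  qed (auto simp: split_beta' space_pair_measure space_PiM PiE_UNIV_domain Pi_iff)
  have d: "distr (coin (p k) \<Otimes>\<^sub>M ?M) ?M (\<lambda>(x, X). X(k := x)) = ?M"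
    using distr_pair_PiM_eq_PiM[where I=UNIV and M="\<lambda>n. coin (p n)" and i'=k] pr
    by (simp add: coin_space_def)
  have "(\<integral>\<^sup>+\<omega>. g \<omega> \<partial>?M) = (\<integral>\<^sup>+z. g (case z of (x, X) \<Rightarrow> X(k := x)) \<partial>(coin (p k) \<Otimes>\<^sub>M ?M))"
    by (subst d[symmetric], rule nn_integral_distr) (use m in auto)
  also have "\<dots> = (\<integral>\<^sup>+x. \<integral>\<^sup>+X. g (X(k := x)) \<partial>?M \<partial>coin (p k))"
    using sigma_finite_measure.nn_integral_fst[OF P.sigma_finite_measure_axioms
        measurable_compose[OF m assms(2)]]
    by simp
  also have "\<dots> = (\<Sum>x\<in>{-1, 1}. (if x = 1 then ennreal (p k) else ennreal (1 - p k)) *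
      (\<integral>\<^sup>+X. g (X(k := x)) \<partial>?M))"
    unfolding coin_def by (rule nn_integral_point_measure_finite) simp
  finally show ?thesis by (simp add: add.commute)
qed

lemma measurable_coin_space_upd:
  assumes "c \<in> {-1, 1}"
  shows "(\<lambda>\<omega>. \<omega> (k := c)) \<in> measurable (coin_space p) (coin_space p)"
  unfolding coin_space_def
proof (rule measurable_PiM_single')
  fix i :: nat
  show "(\<lambda>\<omega>. (\<omega> (k := c)) i) \<in> measurable (\<Pi>\<^sub>M n\<in>UNIV. coin (p n)) (coin (p i))"
    using assms by (cases "i = k") auto
qed (use assms in \<open>auto simp: space_PiM PiE_UNIV_domain Pi_iff\<close>)

lemma L2_coin_space_upd:
  assumes p: "\<And>n. 0 < p n \<and> p n < 1" and f: "f \<in> L2 (coin_space p)"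
  shows "(\<lambda>\<omega>. f (\<omega> (k := 1))) \<in> L2 (coin_space p)"
    and "(\<lambda>\<omega>. f (\<omega> (k := -1))) \<in> L2 (coin_space p)"
    and "(\<integral>\<omega>. (f \<omega>)\<^sup>2 \<partial>coin_space p) =
      p k * (\<integral>\<omega>. (f (\<omega> (k := 1)))\<^sup>2 \<partial>coin_space p) +
      (1 - p k) * (\<integral>\<omega>. (f (\<omega> (k := -1)))\<^sup>2 \<partial>coin_space p)"
proof -
  let ?M = "coin_space p"
  have [measurable]: "f \<in> borel_measurable ?M" and i: "integrable ?M (\<lambda>\<omega>. (f \<omega>)\<^sup>2)"
    using f by (auto simp: L2_def)
  have mp: "(\<lambda>\<omega>. f (\<omega> (k := c))) \<in> borel_measurable ?M" if "c \<in> {-1, 1}" for c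
    using measurable_compose[OF measurable_coin_space_upd[OF that] \<open>f \<in> borel_measurable ?M\<close>] .
  have m1 [measurable]: "(\<lambda>\<omega>. f (\<omega> (k := 1))) \<in> borel_measurable ?M"
    and m2 [measurable]: "(\<lambda>\<omega>. f (\<omega> (k := -1))) \<in> borel_measurable ?M"
    using mp by auto
  have eq: "(\<integral>\<^sup>+\<omega>. ennreal ((f \<omega>)\<^sup>2) \<partial>?M) =
    ennreal (p k) * (\<integral>\<^sup>+\<omega>. ennreal ((f (\<omega> (k := 1)))\<^sup>2) \<partial>?M) +
    ennreal (1 - p k) * (\<integral>\<^sup>+\<omega>. ennreal ((f (\<omega> (k := -1)))\<^sup>2) \<partial>?M)"
    by (rule nn_integral_coin_space_upd[OF p]) measurable
  have "(\<integral>\<^sup>+\<omega>. ennreal ((f \<omega>)\<^sup>2) \<partial>?M) < \<infinity>"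
    using i by (simp add: integrable_iff_bounded)
  then have "(\<integral>\<^sup>+\<omega>. ennreal ((f (\<omega> (k := 1)))\<^sup>2) \<partial>?M) < \<infinity>"
    and "(\<integral>\<^sup>+\<omega>. ennreal ((f (\<omega> (k := -1)))\<^sup>2) \<partial>?M) < \<infinity>"
    unfolding eq using p[of k] by (auto simp: ennreal_mult_less_top)
  then have i1: "integrable ?M (\<lambda>\<omega>. (f (\<omega> (k := 1)))\<^sup>2)"
    and i2: "integrable ?M (\<lambda>\<omega>. (f (\<omega> (k := -1)))\<^sup>2)"
    by (auto simp: integrable_iff_bounded)
  show "(\<lambda>\<omega>. f (\<omega> (k := 1))) \<in> L2 ?M" "(\<lambda>\<omega>. f (\<omega> (k := -1))) \<in> L2 ?M"
    using i1 i2 by (auto simp: L2_def)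
  show "(\<integral>\<omega>. (f \<omega>)\<^sup>2 \<partial>?M) = p k * (\<integral>\<omega>. (f (\<omega> (k := 1)))\<^sup>2 \<partial>?M) +
      (1 - p k) * (\<integral>\<omega>. (f (\<omega> (k := -1)))\<^sup>2 \<partial>?M)"
    using eq p[of k]
    by (simp add: nn_integral_eq_integral i i1 i2 less_imp_le flip: ennreal_mult ennreal_plus)
qed

lemma ex_is_annihilation:
  assumes p: "\<And>n. 0 < p n \<and> p n < 1"
  shows "\<exists>T. is_annihilation p k T"
proof
  let ?M = "coin_space p"
  define s where "s = sqrt (p k * (1 - p k))"
  have s: "s > 0" "s\<^sup>2 = p k * (1 - p k)"
    using p[of k] by (auto simp: s_def)
  define T :: "((nat \<Rightarrow> real) \<Rightarrow> real) \<Rightarrow> (nat \<Rightarrow> real) \<Rightarrow> real"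
    where "T = (\<lambda>f \<omega>. s * f (\<omega> (k := 1)) + (- s) * f (\<omega> (k := -1)))"
  have T: "T f \<in> L2 ?M" if "f \<in> L2 ?M" for f
    unfolding T_def by (intro L2_lincomb L2_coin_space_upd p that)
  have bound: "L2_norm ?M (T f) \<le> sqrt 2 * L2_norm ?M f" if f: "f \<in> L2 ?M" for f
  proof -
    let ?a = "\<lambda>\<omega>. (f (\<omega> (k := 1)))\<^sup>2" and ?b = "\<lambda>\<omega>. (f (\<omega> (k := -1)))\<^sup>2"
    have i: "integrable ?M ?a" "integrable ?M ?b" "integrable ?M (\<lambda>\<omega>. (T f \<omega>)\<^sup>2)"
      using L2_coin_space_upd(1,2)[OF p f] T[OF f] by (auto simp: L2_def)
    have "(\<integral>\<omega>. (T f \<omega>)\<^sup>2 \<partial>?M) \<le> (\<integral>\<omega>. 2 * s\<^sup>2 * ?a \<omega> + 2 * s\<^sup>2 * ?b \<omega> \<partial>?M)"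
    proof (rule integral_mono)
      fix \<omega>
      have "(T f \<omega>)\<^sup>2 + (s * f (\<omega> (k := 1)) + s * f (\<omega> (k := -1)))\<^sup>2 = 2 * s\<^sup>2 * ?a \<omega> + 2 * s\<^sup>2 * ?b \<omega>"
        unfolding T_def by algebra
      moreover have "0 \<le> (s * f (\<omega> (k := 1)) + s * f (\<omega> (k := -1)))\<^sup>2" by simp
      ultimately show "(T f \<omega>)\<^sup>2 \<le> 2 * s\<^sup>2 * ?a \<omega> + 2 * s\<^sup>2 * ?b \<omega>" by linarith
    qed (use i in auto)
    also have "\<dots> = 2 * s\<^sup>2 * (\<integral>\<omega>. ?a \<omega> \<partial>?M) + 2 * s\<^sup>2 * (\<integral>\<omega>. ?b \<omega> \<partial>?M)"
      using i by simp
    also have "\<dots> \<le> 2 * p k * (\<integral>\<omega>. ?a \<omega> \<partial>?M) + 2 * (1 - p k) * (\<integral>\<omega>. ?b \<omega> \<partial>?M)"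
    proof -
      have "s\<^sup>2 \<le> p k" "s\<^sup>2 \<le> 1 - p k"
        unfolding s using p[of k] by (auto simp: mult_le_cancel_left1 mult_le_cancel_right1)
      then show ?thesis
        by (intro add_mono mult_right_mono) auto
    qed
    also have "\<dots> = 2 * (\<integral>\<omega>. (f \<omega>)\<^sup>2 \<partial>?M)"
      using L2_coin_space_upd(3)[OF p f, of k] by simp
    finally show ?thesis
      by (simp add: L2_norm_def L2_inner_def power2_eq_square flip: real_sqrt_mult)
  qed
  have "T (Z p \<sigma>) \<omega> = indicator \<sigma> k * Z p (\<sigma> - {k}) \<omega>" if "finite \<sigma>" for \<sigma> \<omega>
  proof -
    have upd: "Z p (\<sigma> - {k}) (\<omega> (k := c)) = Z p (\<sigma> - {k}) \<omega>" for c
      unfolding Z_def by (intro prod.cong) auto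
    show ?thesis
    proof (cases "k \<in> \<sigma>")
      case True
      have Z: "Z p \<sigma> \<omega>' = (\<omega>' k + (1 - p k) - p k) / (2 * s) * Z p (\<sigma> - {k}) \<omega>'" for \<omega>'
        unfolding Z_def s_def by (rule prod.remove) (use that True in auto)
      show ?thesis
        using True s(1) unfolding T_def Z[of "\<omega> (k := _)"] upd by (simp add: field_simps)
    next
      case False
      then show ?thesis using upd by (simp add: T_def)
    qed
  qed
  then show "is_annihilation p k T"
    unfolding is_annihilation_def bounded_linear_L2_def
    using T bound
    by (intro conjI ballI allI impI exI[of _ "sqrt 2"] AE_I2) (auto simp: T_def algebra_simps)
qed

end

theory Submission
  imports Defs
begin

text \<open>
  The annihilation operator \<open>\<partial>\<^sub>k\<close> is a difference operator: almost surely
  \<open>\<partial>\<^sub>k \<xi> (\<omega>) = \<surd>(p\<^sub>k q\<^sub>k) (\<xi>(\<omega> with \<omega>\<^sub>k := 1) - \<xi>(\<omega> with \<omega>\<^sub>k := -1))\<close>.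
  Composing \<open>\<xi>\<close> with a contraction function shrinks this difference at every point, hence
  \<open>\<parallel>\<partial>\<^sub>k (C \<circ> \<xi>)\<parallel> \<le> \<parallel>\<partial>\<^sub>k \<xi>\<parallel>\<close> for each \<open>k\<close>, and the energy inequality follows term by term.

  Two facts are needed to turn this into a proof. First, the defining properties of \<open>\<partial>\<^sub>k\<close> only
  prescribe it on the \<open>Z\<^sub>\<sigma>\<close>; that they force the formula above rests on the density of the span
  of the \<open>Z\<^sub>\<sigma>\<close> in \<open>L\<^sup>2\<close> (\<open>L2_closure_span_Z\<close>, \<open>annihilation_eq_gradient\<close>). Density holds because
  a product of finitely many \<open>1{\<omega>\<^sub>j = 1} = p\<^sub>j + \<surd>(p\<^sub>j q\<^sub>j) Z\<^sub>j\<close> expands into a combination of the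
  \<open>Z\<^sub>\<sigma>\<close>, and the corresponding events form a \<open>\<pi>\<close>-system generating the \<open>\<sigma>\<close>-field.

  Second, the domain is defined by the chaos coefficients, whereas the contraction acts
  pointwise. The bridge is the identity
  \<open>\<Sum>\<^sub>\<sigma> #\<^sub>w(\<sigma>) \<langle>Z\<^sub>\<sigma>, \<xi>\<rangle>\<^sup>2 = \<Sum>\<^sub>k w(k) \<parallel>\<partial>\<^sub>k \<xi>\<parallel>\<^sup>2\<close>,
  used in the form that both series converge or neither does (\<open>energy_domain_iff_gradient\<close>).
  It comes from Parseval's equation for \<open>\<partial>\<^sub>k \<xi>\<close>, since \<open>\<langle>Z\<^sub>\<tau>, \<partial>\<^sub>k \<xi>\<rangle>\<close> equals
  \<open>\<langle>Z\<^bsub>\<tau> \<union> {k}\<^esub>, \<xi>\<rangle>\<close> if \<open>k \<notin> \<tau>\<close> and vanishes otherwise, and from Tonelli's theorem.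
\<close>

section \<open>Square integrable functions and their approximation\<close>

lemma L2_measurable [measurable_dest]: "f \<in> L2 M \<Longrightarrow> f \<in> borel_measurable M"
  by (simp add: L2_def)

lemma L2_integrable_mult:
  assumes "f \<in> L2 M" "g \<in> L2 M"
  shows "integrable M (\<lambda>x. f x * g x)"
proof -
  note [measurable] = assms[THEN L2_measurable]
  have "integrable M (\<lambda>x. (f x)\<^sup>2 + (g x)\<^sup>2)"
    using assms by (simp add: L2_def)
  then show ?thesis
  proof (rule Bochner_Integration.integrable_bound, measurable, intro AE_I2)
    fix x
    have "0 \<le> (\<bar>f x\<bar> - \<bar>g x\<bar>)\<^sup>2" "0 \<le> \<bar>f x\<bar> * \<bar>g x\<bar>" by simp_all
    then have "\<bar>f x\<bar> * \<bar>g x\<bar> \<le> (f x)\<^sup>2 + (g x)\<^sup>2"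
      unfolding power2_diff power2_abs by linarith
    then show "norm (f x * g x) \<le> norm ((f x)\<^sup>2 + (g x)\<^sup>2)"
      by (simp add: abs_mult)
  qed
qed

lemma L2_diff: "f \<in> L2 M \<Longrightarrow> g \<in> L2 M \<Longrightarrow> (\<lambda>x. f x - g x) \<in> L2 M"
  using L2_lincomb[of f M g 1 "-1"] by simp

lemma L2_sum:
  assumes "\<And>i. i \<in> F \<Longrightarrow> e i \<in> L2 M"
  shows "(\<lambda>x. \<Sum>i\<in>F. a i * e i x) \<in> L2 M"
  using assms
proof (induction F rule: infinite_finite_induct)
  case (insert i F)
  then show ?case
    using L2_lincomb[of "e i" M "\<lambda>x. \<Sum>i\<in>F. a i * e i x" "a i" 1] by simp
qed (simp_all add: L2_def)

lemma L2_bounded: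
  assumes "finite_measure M" "f \<in> borel_measurable M" "\<And>x. x \<in> space M \<Longrightarrow> \<bar>f x\<bar> \<le> B"
  shows "f \<in> L2 M"
proof -
  interpret finite_measure M by fact
  have "integrable M (\<lambda>x. (f x)\<^sup>2)"
  proof (rule integrable_const_bound[where B = "B\<^sup>2"])
    show "AE x in M. norm ((f x)\<^sup>2) \<le> B\<^sup>2"
      using assms(3) by (intro AE_I2) (simp add: abs_le_square_iff[symmetric], force)
  qed (use assms(2) in measurable)
  then show ?thesis using assms(2) by (simp add: L2_def)
qed

definition L2_dist2 :: "'a measure \<Rightarrow> ('a \<Rightarrow> real) \<Rightarrow> ('a \<Rightarrow> real) \<Rightarrow> real" where
  "L2_dist2 M f g = (\<integral>x. (f x - g x)\<^sup>2 \<partial>M)"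

lemma L2_dist2_nonneg: "0 \<le> L2_dist2 M f g"
  by (simp add: L2_dist2_def)

lemma integrable_L2_dist2:
  "f \<in> L2 M \<Longrightarrow> g \<in> L2 M \<Longrightarrow> integrable M (\<lambda>x. (f x - g x)\<^sup>2)"
  using L2_diff[of f M g] by (simp add: L2_def)

lemma L2_dist2_lincomb:
  assumes "f \<in> L2 M" "f' \<in> L2 M" "g \<in> L2 M" "g' \<in> L2 M"
  shows "L2_dist2 M (\<lambda>x. a * f x + b * g x) (\<lambda>x. a * f' x + b * g' x)
    \<le> 2 * a\<^sup>2 * L2_dist2 M f f' + 2 * b\<^sup>2 * L2_dist2 M g g'"
proof -
  have "L2_dist2 M (\<lambda>x. a * f x + b * g x) (\<lambda>x. a * f' x + b * g' x)
      \<le> (\<integral>x. 2 * a\<^sup>2 * (f x - f' x)\<^sup>2 + 2 * b\<^sup>2 * (g x - g' x)\<^sup>2 \<partial>M)"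
    unfolding L2_dist2_def
  proof (rule integral_mono)
    fix x
    have "(a * f x + b * g x - (a * f' x + b * g' x))\<^sup>2
        + (a * (f x - f' x) - b * (g x - g' x))\<^sup>2
        = 2 * a\<^sup>2 * (f x - f' x)\<^sup>2 + 2 * b\<^sup>2 * (g x - g' x)\<^sup>2"
      by algebra
    moreover have "0 \<le> (a * (f x - f' x) - b * (g x - g' x))\<^sup>2" by simp
    ultimately show "(a * f x + b * g x - (a * f' x + b * g' x))\<^sup>2
        \<le> 2 * a\<^sup>2 * (f x - f' x)\<^sup>2 + 2 * b\<^sup>2 * (g x - g' x)\<^sup>2"
      by linarith
  qed (use assms in \<open>auto intro!: integrable_L2_dist2 L2_lincomb\<close>)
  also have "\<dots> = 2 * a\<^sup>2 * L2_dist2 M f f' + 2 * b\<^sup>2 * L2_dist2 M g g'"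
    using assms by (simp add: L2_dist2_def integrable_L2_dist2)
  finally show ?thesis .
qed

lemma L2_dist2_triangle:
  assumes "f \<in> L2 M" "g \<in> L2 M" "h \<in> L2 M"
  shows "L2_dist2 M f h \<le> 2 * L2_dist2 M f g + 2 * L2_dist2 M g h"
  using L2_dist2_lincomb[of f M g g h 1 1] assms L2_lincomb[of g M g 1 0]
  by (simp add: L2_dist2_def)

text \<open>
  The closure in the \<open>L\<^sup>2\<close> pseudometric, for sets of representatives. Squared distances
  are used throughout, because they are additive along orthogonal decompositions; the price is the
  factor \<open>2\<close> in the triangle inequality.
\<close>

definition L2_closure :: "'a measure \<Rightarrow> ('a \<Rightarrow> real) set \<Rightarrow> ('a \<Rightarrow> real) set" where
  "L2_closure M S = {f \<in> L2 M. \<forall>\<epsilon>>0. \<exists>g\<in>S. L2_dist2 M f g < \<epsilon>}"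

lemma L2_closure_closed:
  assumes S: "S \<subseteq> L2 M" and f: "f \<in> L2 M"
    and ap: "\<And>\<epsilon>. 0 < \<epsilon> \<Longrightarrow> \<exists>h\<in>L2_closure M S. L2_dist2 M f h < \<epsilon>"
  shows "f \<in> L2_closure M S"
  unfolding L2_closure_def
proof (intro CollectI conjI allI impI f)
  fix \<epsilon> :: real assume "0 < \<epsilon>"
  then obtain h where h: "h \<in> L2_closure M S" "L2_dist2 M f h < \<epsilon> / 4"
    using ap[of "\<epsilon> / 4"] by auto
  then obtain g where g: "g \<in> S" "L2_dist2 M h g < \<epsilon> / 4"
    using \<open>0 < \<epsilon>\<close> unfolding L2_closure_def by (auto dest!: spec[of _ "\<epsilon> / 4"])
  have "L2_dist2 M f g < \<epsilon>"
    using L2_dist2_triangle[of f M h g] f h g S by (auto simp: L2_closure_def)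
  then show "\<exists>g\<in>S. L2_dist2 M f g < \<epsilon>" using g by blast
qed

lemma L2_closure_lincomb:
  assumes S: "S \<subseteq> L2 M"
    and lin: "\<And>f g a b. f \<in> S \<Longrightarrow> g \<in> S \<Longrightarrow> (\<lambda>x. a * f x + b * g x) \<in> S"
    and f: "f \<in> L2_closure M S" and g: "g \<in> L2_closure M S"
  shows "(\<lambda>x. a * f x + b * g x) \<in> L2_closure M S"
  unfolding L2_closure_def
proof (intro CollectI conjI allI impI)
  show "(\<lambda>x. a * f x + b * g x) \<in> L2 M"
    using f g by (auto simp: L2_closure_def intro: L2_lincomb)
  fix \<epsilon> :: real assume "0 < \<epsilon>"
  \<comment> \<open>The summand \<open>1\<close> keeps the denominator positive when both coefficients vanish.\<close>
  define \<delta> where "\<delta> = \<epsilon> / (2 * a\<^sup>2 + 2 * b\<^sup>2 + 1)"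
  have pos: "0 < 2 * a\<^sup>2 + 2 * b\<^sup>2 + 1" by (simp add: add_nonneg_pos)
  then have \<delta>: "0 < \<delta>" using \<open>0 < \<epsilon>\<close> by (simp add: \<delta>_def)
  obtain f' g' where f': "f' \<in> S" "L2_dist2 M f f' < \<delta>" and g': "g' \<in> S" "L2_dist2 M g g' < \<delta>"
    using f g \<delta> unfolding L2_closure_def by blast
  have "L2_dist2 M (\<lambda>x. a * f x + b * g x) (\<lambda>x. a * f' x + b * g' x)
      \<le> 2 * a\<^sup>2 * L2_dist2 M f f' + 2 * b\<^sup>2 * L2_dist2 M g g'"
    using f g f' g' S by (intro L2_dist2_lincomb) (auto simp: L2_closure_def)
  also have "\<dots> \<le> 2 * a\<^sup>2 * \<delta> + 2 * b\<^sup>2 * \<delta>"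
    using f' g' by (intro add_mono mult_left_mono) auto
  also have "\<dots> < (2 * a\<^sup>2 + 2 * b\<^sup>2 + 1) * \<delta>"
    using \<delta> by (simp add: algebra_simps)
  also have "\<dots> = \<epsilon>" using pos by (simp add: \<delta>_def)
  finally show "\<exists>h\<in>S. L2_dist2 M (\<lambda>x. a * f x + b * g x) h < \<epsilon>"
    using lin f' g' by blast
qed

text \<open>
  The constant \<open>2\<close> in the domination is the one with which simple functions approximate a
  measurable function; it gives \<open>\<bar>f - s\<^sub>i\<bar> \<le> 3 \<bar>f\<bar>\<close> and thus the dominating function \<open>9 f\<^sup>2\<close>.
\<close>

lemma L2_closure_dominated_limit:
  assumes S: "S \<subseteq> L2 M" and f: "f \<in> L2 M"
    and s: "\<And>i::nat. s i \<in> L2_closure M S"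
    and lim: "\<And>x. x \<in> space M \<Longrightarrow> (\<lambda>i. s i x) \<longlonglongrightarrow> f x"
    and bound: "\<And>i x. x \<in> space M \<Longrightarrow> \<bar>s i x\<bar> \<le> 2 * \<bar>f x\<bar>"
  shows "f \<in> L2_closure M S"
proof (rule L2_closure_closed[OF S f])
  fix \<epsilon> :: real assume "0 < \<epsilon>"
  have sL: "s i \<in> L2 M" for i using s by (auto simp: L2_closure_def)
  note [measurable] = L2_measurable[OF f] L2_measurable[OF sL]
  have "(\<lambda>i. \<integral>x. (f x - s i x)\<^sup>2 \<partial>M) \<longlonglongrightarrow> (\<integral>x. 0 \<partial>M)"
  proof (rule integral_dominated_convergence[where w = "\<lambda>x. 9 * (f x)\<^sup>2"])
    show "integrable M (\<lambda>x. 9 * (f x)\<^sup>2)" using f by (simp add: L2_def)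
    show "AE x in M. (\<lambda>i. (f x - s i x)\<^sup>2) \<longlonglongrightarrow> 0"
    proof (rule AE_I2)
      fix x assume "x \<in> space M"
      from tendsto_power[OF tendsto_diff[OF tendsto_const lim[OF this]], of "f x" 2]
      show "(\<lambda>i. (f x - s i x)\<^sup>2) \<longlonglongrightarrow> 0" by simp
    qed
    show "AE x in M. norm ((f x - s i x)\<^sup>2) \<le> 9 * (f x)\<^sup>2" for i
    proof (rule AE_I2)
      fix x assume "x \<in> space M"
      from bound[OF this, of i] have "\<bar>f x - s i x\<bar> \<le> \<bar>3 * f x\<bar>" by linarith
      then have "(f x - s i x)\<^sup>2 \<le> (3 * f x)\<^sup>2" by (simp only: abs_le_square_iff)
      then show "norm ((f x - s i x)\<^sup>2) \<le> 9 * (f x)\<^sup>2" by (simp add: power_mult_distrib)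
    qed
  qed measurable
  then have "(\<lambda>i. L2_dist2 M f (s i)) \<longlonglongrightarrow> 0" by (simp add: L2_dist2_def)
  then have "eventually (\<lambda>i. L2_dist2 M f (s i) < \<epsilon>) sequentially"
    using \<open>0 < \<epsilon>\<close> by (rule order_tendstoD)
  then obtain i where "L2_dist2 M f (s i) < \<epsilon>" by (auto simp: eventually_sequentially)
  then show "\<exists>h\<in>L2_closure M S. L2_dist2 M f h < \<epsilon>" using s by blast
qed

text \<open>
  By Dynkin's argument, the sets whose indicator lies in the closure contain the \<open>\<sigma>\<close>-field
  generated by the \<open>\<pi>\<close>-system: complements are differences and disjoint unions are dominated limits
  of partial sums. From indicators one reaches simple functions, and from these all of \<open>L\<^sup>2\<close>.
\<close>

lemma L2_closure_generator:
  assumes fin: "finite_measure M"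
    and gen: "sets M = sigma_sets (space M) G" "G \<subseteq> Pow (space M)" "Int_stable G" "space M \<in> G"
    and S: "S \<subseteq> L2 M"
    and lin: "\<And>f g a b. f \<in> S \<Longrightarrow> g \<in> S \<Longrightarrow> (\<lambda>x. a * f x + b * g x) \<in> S"
    and ind: "\<And>A. A \<in> G \<Longrightarrow> \<exists>g\<in>S. \<forall>x\<in>space M. g x = indicator A x"
  shows "L2_closure M S = L2 M"
proof
  interpret finite_measure M by fact
  have cl_lin: "(\<lambda>x. a * f x + b * g x) \<in> L2_closure M S"
    if "f \<in> L2_closure M S" "g \<in> L2_closure M S" for f g a b
    using L2_closure_lincomb[OF S _ that] lin by blast
  have indL: "indicator A \<in> L2 M" if "A \<in> sets M" for A
    by (rule L2_bounded[OF fin, where B = 1]) (use that in \<open>auto simp: indicator_def\<close>)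
  have base: "indicator A \<in> L2_closure M S" if A: "A \<in> G" for A
  proof -
    from ind[OF A] obtain g where g: "g \<in> S" "\<forall>x\<in>space M. g x = indicator A x" by blast
    have "A \<in> sets M" using A gen(1) by auto
    moreover have "L2_dist2 M (indicator A) g = (\<integral>x. 0 \<partial>M)"
      unfolding L2_dist2_def using g by (intro Bochner_Integration.integral_cong) auto
    ultimately show ?thesis
      using indL g by (auto simp: L2_closure_def intro!: bexI[of _ g])
  qed
  have one: "indicator (space M) \<in> L2_closure M S" by (rule base[OF gen(4)])
  have zero: "(\<lambda>x. 0) \<in> L2_closure M S" using cl_lin[OF one one, of 0 0] by simp
  have sum: "(\<lambda>x. \<Sum>i\<in>I. a i * f i x) \<in> L2_closure M S"
    if "\<And>i. i \<in> I \<Longrightarrow> f i \<in> L2_closure M S" for I :: "'i set" and a f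
    using that
  proof (induction I rule: infinite_finite_induct)
    case (insert i I)
    then show ?case
      using cl_lin[of "f i" "\<lambda>x. \<Sum>i\<in>I. a i * f i x" "a i" 1] by simp
  qed (simp_all add: zero)
  have sets: "indicator A \<in> L2_closure M S" if "A \<in> sets M" for A
    using gen(3,2) that[unfolded gen(1)]
  proof (induction A rule: sigma_sets_induct_disjoint)
    case (basic A)
    then show ?case by (rule base)
  next
    case empty
    then show ?case using zero by (simp add: indicator_def)
  next
    case (compl A)
    then have "A \<subseteq> space M" using gen(1) sets.sets_into_space by blast
    then have "(\<lambda>x. 1 * indicator (space M) x + (-1) * indicator A x) = (indicator (space M - A) :: 'a \<Rightarrow> real)"
      by (auto simp: indicator_def fun_eq_iff)
    then show ?case using cl_lin[OF one compl(2), of 1 "-1"] by simp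
  next
    case (union A)
    have Asets: "A i \<in> sets M" for i using union(2) gen(1) by auto
    show ?case
    proof (rule L2_closure_dominated_limit[OF S, where s = "\<lambda>n x. \<Sum>i<n. 1 * indicator (A i) x"])
      show "indicator (\<Union>i. A i) \<in> L2 M" using Asets by (intro indL) auto
      show "(\<lambda>x. \<Sum>i<n. 1 * indicator (A i) x) \<in> L2_closure M S" for n
        by (rule sum) (rule union(3))
      have eq: "(\<Sum>i<n. 1 * indicator (A i) x) = (indicator (\<Union>i<n. A i) x :: real)" for n x
      proof -
        have "disjoint_family_on A {..<n}" using union(1) by (auto simp: disjoint_family_on_def)
        then show ?thesis by (simp add: indicator_UN_disjoint)
      qed
      show "(\<lambda>n. \<Sum>i<n. 1 * indicator (A i) x) \<longlonglongrightarrow> (indicator (\<Union>i. A i) x :: real)" for x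
        unfolding eq by (rule LIMSEQ_indicator_UN)
      show "\<bar>\<Sum>i<n. 1 * indicator (A i) x\<bar> \<le> 2 * \<bar>indicator (\<Union>i. A i) x :: real\<bar>" for n x
        unfolding eq by (auto simp: indicator_def)
    qed
  qed
  show "L2 M \<subseteq> L2_closure M S"
  proof
    fix f assume f: "f \<in> L2 M"
    from borel_measurable_implies_sequence_metric[OF L2_measurable[OF f], of 0]
    obtain s where "\<forall>i. simple_function M (s i)"
      "\<forall>x\<in>space M. (\<lambda>i. s i x) \<longlonglongrightarrow> f x"
      "\<forall>i. \<forall>x\<in>space M. \<bar>s i x\<bar> \<le> 2 * \<bar>f x\<bar>"
      unfolding dist_real_def diff_0_right by (elim exE conjE)
    then have s: "\<And>i. simple_function M (s i)"
      "\<And>x. x \<in> space M \<Longrightarrow> (\<lambda>i. s i x) \<longlonglongrightarrow> f x"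
      "\<And>i x. x \<in> space M \<Longrightarrow> \<bar>s i x\<bar> \<le> 2 * \<bar>f x\<bar>"
      by (blast, blast, blast)
    define t where "t i x = (\<Sum>y\<in>s i ` space M. y * indicator (s i -` {y} \<inter> space M) x)" for i x
    have rep: "t i x = s i x" if "x \<in> space M" for i x
      unfolding t_def simple_function_indicator_representation_banach[OF s(1) that, of i]
      by (intro sum.cong refl) (simp only: real_scaleR_def mult.commute)
    show "f \<in> L2_closure M S"
    proof (rule L2_closure_dominated_limit[OF S f, where s = t])
      show "t i \<in> L2_closure M S" for i
        unfolding t_def
      proof (rule sum)
        show "indicator (s i -` {y} \<inter> space M) \<in> L2_closure M S" for y
          by (rule sets) (rule simple_functionD(2)[OF s(1)])
      qed
      fix x assume x: "x \<in> space M"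
      show "(\<lambda>i. t i x) \<longlonglongrightarrow> f x" unfolding rep[OF x] by (rule s(2)[OF x])
      show "\<bar>t i x\<bar> \<le> 2 * \<bar>f x\<bar>" for i unfolding rep[OF x] by (rule s(3)[OF x])
    qed
  qed
qed (auto simp: L2_closure_def)

section \<open>Parseval's equation\<close>

lemma L2_inner_sum_right:
  assumes "f \<in> L2 M" "\<And>i. i \<in> F \<Longrightarrow> e i \<in> L2 M"
  shows "L2_inner M f (\<lambda>x. \<Sum>i\<in>F. a i * e i x) = (\<Sum>i\<in>F. a i * L2_inner M f (e i))"
proof -
  have "L2_inner M f (\<lambda>x. \<Sum>i\<in>F. a i * e i x) = (\<integral>x. (\<Sum>i\<in>F. a i * (f x * e i x)) \<partial>M)"
    unfolding L2_inner_def by (simp add: sum_distrib_left algebra_simps)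
  also have "\<dots> = (\<Sum>i\<in>F. a i * L2_inner M f (e i))"
    unfolding L2_inner_def using assms L2_integrable_mult
    by (subst Bochner_Integration.integral_sum) auto
  finally show ?thesis .
qed

lemma L2_inner_commute: "L2_inner M f g = L2_inner M g f"
  by (simp add: L2_inner_def mult.commute)

lemma L2_dist2_expand:
  assumes "f \<in> L2 M" "g \<in> L2 M"
  shows "L2_dist2 M f g = L2_inner M f f - 2 * L2_inner M f g + L2_inner M g g"
proof -
  have "L2_dist2 M f g = (\<integral>x. f x * f x - 2 * (f x * g x) + g x * g x \<partial>M)"
    unfolding L2_dist2_def
    by (intro Bochner_Integration.integral_cong) (auto simp: power2_eq_square algebra_simps)
  then show ?thesis
    using assms by (simp add: L2_inner_def L2_integrable_mult)
qed

text \<open>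
  Completing the square: the distance to a finite combination splits into the part of \<open>f\<close> outside
  the span and the error of the coefficients. The choice \<open>a i = \<langle>e i, f\<rangle>\<close> gives Bessel's inequality.
\<close>

lemma L2_dist2_orthonormal_sum:
  assumes f: "f \<in> L2 M" and F: "finite F" and e: "\<And>i. i \<in> F \<Longrightarrow> e i \<in> L2 M"
    and ortho: "\<And>i j. i \<in> F \<Longrightarrow> j \<in> F \<Longrightarrow> L2_inner M (e i) (e j) = (if i = j then 1 else 0)"
  shows "L2_dist2 M f (\<lambda>x. \<Sum>i\<in>F. a i * e i x) = L2_inner M f f
    - (\<Sum>i\<in>F. (L2_inner M (e i) f)\<^sup>2) + (\<Sum>i\<in>F. (L2_inner M (e i) f - a i)\<^sup>2)"
proof -
  let ?g = "\<lambda>x. \<Sum>i\<in>F. a i * e i x"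
  have g: "?g \<in> L2 M" by (rule L2_sum) (rule e)
  have eg: "L2_inner M ?g (e i) = a i" if "i \<in> F" for i
  proof -
    have "L2_inner M ?g (e i) = (\<Sum>j\<in>F. a j * L2_inner M (e i) (e j))"
      unfolding L2_inner_commute[of M ?g] by (rule L2_inner_sum_right) (use e that in auto)
    also have "\<dots> = (\<Sum>j\<in>F. if i = j then a j else 0)"
      using ortho that by (intro sum.cong) auto
    finally show ?thesis using that F by simp
  qed
  have "L2_inner M ?g ?g = (\<Sum>i\<in>F. a i * a i)"
    using L2_inner_sum_right[of ?g M F e a, OF g e] eg by simp
  moreover have "L2_inner M f ?g = (\<Sum>i\<in>F. a i * L2_inner M (e i) f)"
    using L2_inner_sum_right[of f M F e a, OF f e] by (simp add: L2_inner_commute)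
  ultimately show ?thesis
    unfolding L2_dist2_expand[OF f g]
    by (simp add: power2_eq_square algebra_simps sum.distrib sum_subtractf sum_distrib_left)
qed

definition L2_span :: "('i \<Rightarrow> 'a \<Rightarrow> real) \<Rightarrow> 'i set \<Rightarrow> ('a \<Rightarrow> real) set" where
  "L2_span e I = {(\<lambda>x. \<Sum>i\<in>F. a i * e i x) | F a. finite F \<and> F \<subseteq> I}"

lemma L2_span_lincomb:
  assumes "f \<in> L2_span e I" "g \<in> L2_span e I"
  shows "(\<lambda>x. a * f x + b * g x) \<in> L2_span e I"
proof -
  obtain F c where F: "f = (\<lambda>x. \<Sum>i\<in>F. c i * e i x)" "finite F" "F \<subseteq> I"
    using assms(1) unfolding L2_span_def by blast
  obtain G d where G: "g = (\<lambda>x. \<Sum>i\<in>G. d i * e i x)" "finite G" "G \<subseteq> I"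
    using assms(2) unfolding L2_span_def by blast
  define h where "h i = a * (if i \<in> F then c i else 0) + b * (if i \<in> G then d i else 0)" for i
  have ext: "(\<Sum>i\<in>A. u i * e i x) = (\<Sum>i\<in>F \<union> G. (if i \<in> A then u i else 0) * e i x)"
    if "A \<subseteq> F \<union> G" for A u x
    using that F(2) G(2) by (intro sum.mono_neutral_cong_left) auto
  have "a * f x + b * g x = (\<Sum>i\<in>F \<union> G. h i * e i x)" for x
    unfolding F(1) G(1) h_def ext[of F c x, OF Un_upper1] ext[of G d x, OF Un_upper2]
    by (simp add: sum_distrib_left algebra_simps sum.distrib)
  then show ?thesis unfolding L2_span_def using F G by blast
qed

text \<open>
  Bessel's inequality bounds all finite sums of squared coefficients by \<open>\<parallel>f\<parallel>\<^sup>2\<close>. An approximation of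
  \<open>f\<close> by a combination over \<open>F\<close> up to \<open>\<epsilon>\<close> shows that the sum over \<open>F\<close>, and hence over every larger
  finite set, exceeds \<open>\<parallel>f\<parallel>\<^sup>2 - \<epsilon>\<close>.
\<close>

theorem L2_Parseval:
  assumes e: "\<And>i. i \<in> I \<Longrightarrow> e i \<in> L2 M"
    and ortho: "\<And>i j. i \<in> I \<Longrightarrow> j \<in> I \<Longrightarrow> L2_inner M (e i) (e j) = (if i = j then 1 else 0)"
    and total: "f \<in> L2_closure M (L2_span e I)"
  shows "((\<lambda>i. (L2_inner M (e i) f)\<^sup>2) has_sum L2_inner M f f) I"
proof -
  let ?c = "\<lambda>i. (L2_inner M (e i) f)\<^sup>2"
  have f: "f \<in> L2 M" using total by (simp add: L2_closure_def)
  have id: "L2_dist2 M f (\<lambda>x. \<Sum>i\<in>F. a i * e i x) = L2_inner M f f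
      - (\<Sum>i\<in>F. ?c i) + (\<Sum>i\<in>F. (L2_inner M (e i) f - a i)\<^sup>2)"
    if "finite F" "F \<subseteq> I" for F a
    by (rule L2_dist2_orthonormal_sum) (use f e ortho that in \<open>auto simp: subset_iff\<close>)
  have bessel: "sum ?c F \<le> L2_inner M f f" if "finite F" "F \<subseteq> I" for F
    using id[OF that, of "\<lambda>i. L2_inner M (e i) f"]
      L2_dist2_nonneg[of M f "\<lambda>x. \<Sum>i\<in>F. L2_inner M (e i) f * e i x"] by simp
  show ?thesis
    unfolding has_sum_def tendsto_iff
  proof (intro allI impI)
    fix \<epsilon> :: real assume "0 < \<epsilon>"
    then obtain F a where F: "finite F" "F \<subseteq> I"
      and d: "L2_dist2 M f (\<lambda>x. \<Sum>i\<in>F. a i * e i x) < \<epsilon>"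
      using total unfolding L2_closure_def L2_span_def by blast
    have "0 \<le> (\<Sum>i\<in>F. (L2_inner M (e i) f - a i)\<^sup>2)" by (simp add: sum_nonneg)
    then have low: "L2_inner M f f - \<epsilon> < sum ?c F" using id[OF F, of a] d by linarith
    have "dist (sum ?c Y) (L2_inner M f f) < \<epsilon>" if Y: "finite Y" "F \<subseteq> Y" "Y \<subseteq> I" for Y
    proof -
      have "sum ?c F \<le> sum ?c Y" using Y by (intro sum_mono2) auto
      then show ?thesis using low bessel[of Y] Y \<open>0 < \<epsilon>\<close> by (simp add: dist_real_def)
    qed
    then show "\<forall>\<^sub>F Y in finite_subsets_at_top I. dist (sum ?c Y) (L2_inner M f f) < \<epsilon>"
      unfolding eventually_finite_subsets_at_top using F by blast
  qed
qed

section \<open>The discrete gradient\<close>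

definition discrete_gradient ::
    "(nat \<Rightarrow> real) \<Rightarrow> nat \<Rightarrow> ((nat \<Rightarrow> real) \<Rightarrow> real) \<Rightarrow> (nat \<Rightarrow> real) \<Rightarrow> real" where
  "discrete_gradient p k f \<omega> =
    sqrt (p k * (1 - p k)) * (f (\<omega> (k := 1)) - f (\<omega> (k := - 1)))"

lemma Z_split:
  assumes "finite \<sigma>" "k \<in> \<sigma>"
  shows "Z p \<sigma> \<omega> = (\<omega> k + (1 - p k) - p k) / (2 * sqrt (p k * (1 - p k))) * Z p (\<sigma> - {k}) \<omega>"
  unfolding Z_def by (rule prod.remove) (use assms in auto)

lemma Z_upd: "k \<notin> \<sigma> \<Longrightarrow> Z p \<sigma> (\<omega> (k := c)) = Z p \<sigma> \<omega>"
  unfolding Z_def by (intro prod.cong) auto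

lemma borel_measurable_coordinate: "(\<lambda>\<omega>. \<omega> j) \<in> borel_measurable (coin_space p)"
proof -
  have "(\<lambda>\<omega>. \<omega> j) \<in> measurable (coin_space p) (coin (p j))"
    unfolding coin_space_def by simp
  moreover have "(\<lambda>x. x) \<in> borel_measurable (coin (p j))"
    by (auto simp: measurable_def)
  ultimately show ?thesis by (rule measurable_compose)
qed

lemma Z_L2:
  assumes p: "\<And>n. 0 < p n \<and> p n < 1"
  shows "Z p \<sigma> \<in> L2 (coin_space p)"
proof (rule L2_bounded)
  show "finite_measure (coin_space p)"
    using prob_space_coin_space[OF p] by (rule prob_space.finite_measure)
  note [measurable] = borel_measurable_coordinate
  show "Z p \<sigma> \<in> borel_measurable (coin_space p)"
    unfolding Z_def by measurable
  fix \<omega> assume \<omega>: "\<omega> \<in> space (coin_space p)"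
  show "\<bar>Z p \<sigma> \<omega>\<bar> \<le> (\<Prod>j\<in>\<sigma>. 1 / sqrt (p j * (1 - p j)))"
    unfolding Z_def abs_prod
  proof (rule prod_mono, intro conjI)
    fix j
    have "\<omega> j = 1 \<or> \<omega> j = -1" using \<omega> by (auto simp: space_coin_space)
    then have "\<bar>\<omega> j + (1 - p j) - p j\<bar> \<le> 2" using p[of j] by auto
    moreover have "0 < sqrt (p j * (1 - p j))" using p[of j] by simp
    ultimately show "\<bar>(\<omega> j + (1 - p j) - p j) / (2 * sqrt (p j * (1 - p j)))\<bar>
        \<le> 1 / sqrt (p j * (1 - p j))"
      by (simp add: abs_mult field_simps)
  qed simp
qed

lemma discrete_gradient_L2:
  assumes p: "\<And>n. 0 < p n \<and> p n < 1" and f: "f \<in> L2 (coin_space p)"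
  shows "discrete_gradient p k f \<in> L2 (coin_space p)"
proof -
  have "discrete_gradient p k f = (\<lambda>\<omega>. sqrt (p k * (1 - p k)) * f (\<omega> (k := 1))
      + - sqrt (p k * (1 - p k)) * f (\<omega> (k := - 1)))"
    by (simp add: discrete_gradient_def fun_eq_iff algebra_simps)
  moreover have "\<dots> \<in> L2 (coin_space p)"
    by (intro L2_lincomb L2_coin_space_upd p f)
  ultimately show ?thesis by (simp only:)
qed

lemma discrete_gradient_lincomb:
  "discrete_gradient p k (\<lambda>\<omega>. a * f \<omega> + b * g \<omega>) \<omega>
    = a * discrete_gradient p k f \<omega> + b * discrete_gradient p k g \<omega>"
  by (simp add: discrete_gradient_def algebra_simps)

lemma discrete_gradient_Z:
  assumes p: "\<And>n. 0 < p n \<and> p n < 1" and "finite \<sigma>"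
  shows "discrete_gradient p k (Z p \<sigma>) \<omega> = indicator \<sigma> k * Z p (\<sigma> - {k}) \<omega>"
proof (cases "k \<in> \<sigma>")
  case True
  have "p k \<noteq> 0" "p k \<noteq> 1" using p[of k] by auto
  then show ?thesis
    using True by (simp add: discrete_gradient_def Z_split[OF assms(2) True] Z_upd field_simps)
qed (simp add: discrete_gradient_def Z_upd)

text \<open>
  Writing \<open>a\<close>, \<open>b\<close> for the values of \<open>f\<close> with coordinate \<open>k\<close> set to \<open>1\<close> and \<open>-1\<close>, the squared gradient is the
  conditional variance \<open>p q (a - b)\<^sup>2 = p a\<^sup>2 + q b\<^sup>2 - (p a + q b)\<^sup>2\<close>, which is at most the conditional
  second moment.
\<close>

lemma discrete_gradient_contractive:
  assumes p: "\<And>n. 0 < p n \<and> p n < 1" and f: "f \<in> L2 (coin_space p)"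
  shows "(\<integral>\<omega>. (discrete_gradient p k f \<omega>)\<^sup>2 \<partial>coin_space p) \<le> (\<integral>\<omega>. (f \<omega>)\<^sup>2 \<partial>coin_space p)"
proof -
  let ?a = "\<lambda>\<omega>. f (\<omega> (k := 1))" and ?b = "\<lambda>\<omega>. f (\<omega> (k := - 1))"
  have i: "integrable (coin_space p) (\<lambda>\<omega>. (?a \<omega>)\<^sup>2)" "integrable (coin_space p) (\<lambda>\<omega>. (?b \<omega>)\<^sup>2)"
    "integrable (coin_space p) (\<lambda>\<omega>. (discrete_gradient p k f \<omega>)\<^sup>2)"
    using L2_coin_space_upd(1,2)[OF p f] discrete_gradient_L2[OF p f] by (auto simp: L2_def)
  have "(\<integral>\<omega>. (discrete_gradient p k f \<omega>)\<^sup>2 \<partial>coin_space p)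
      \<le> (\<integral>\<omega>. p k * (?a \<omega>)\<^sup>2 + (1 - p k) * (?b \<omega>)\<^sup>2 \<partial>coin_space p)"
  proof (rule integral_mono)
    fix \<omega>
    have "0 \<le> p k * (1 - p k)" using p[of k] by simp
    then have "(discrete_gradient p k f \<omega>)\<^sup>2 = p k * (1 - p k) * (?a \<omega> - ?b \<omega>)\<^sup>2"
      by (simp add: discrete_gradient_def power_mult_distrib)
    also have "\<dots> = p k * (?a \<omega>)\<^sup>2 + (1 - p k) * (?b \<omega>)\<^sup>2 - (p k * ?a \<omega> + (1 - p k) * ?b \<omega>)\<^sup>2"
      by algebra
    finally show "(discrete_gradient p k f \<omega>)\<^sup>2 \<le> p k * (?a \<omega>)\<^sup>2 + (1 - p k) * (?b \<omega>)\<^sup>2"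
      using zero_le_power2[of "p k * ?a \<omega> + (1 - p k) * ?b \<omega>"] by linarith
  qed (use i in auto)
  also have "\<dots> = (\<integral>\<omega>. (f \<omega>)\<^sup>2 \<partial>coin_space p)"
    using i L2_coin_space_upd(3)[OF p f, of k] by simp
  finally show ?thesis .
qed

lemma L2_inner_polarization:
  assumes "f \<in> L2 M" "g \<in> L2 M"
  shows "4 * L2_inner M f g = (\<integral>x. (1 * f x + 1 * g x)\<^sup>2 \<partial>M) - (\<integral>x. (1 * f x + (-1) * g x)\<^sup>2 \<partial>M)"
proof -
  have "integrable M (\<lambda>x. (1 * f x + 1 * g x)\<^sup>2)" "integrable M (\<lambda>x. (1 * f x + (-1) * g x)\<^sup>2)"
    using L2_lincomb[OF assms] unfolding L2_def by blast+
  then have "(\<integral>x. (1 * f x + 1 * g x)\<^sup>2 \<partial>M) - (\<integral>x. (1 * f x + (-1) * g x)\<^sup>2 \<partial>M)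
      = (\<integral>x. (1 * f x + 1 * g x)\<^sup>2 - (1 * f x + (-1) * g x)\<^sup>2 \<partial>M)"
    by simp
  also have "\<dots> = (\<integral>x. 4 * (f x * g x) \<partial>M)"
    by (intro Bochner_Integration.integral_cong) (auto simp: power2_eq_square algebra_simps)
  finally show ?thesis by (simp add: L2_inner_def)
qed

text \<open>
  Conditioning on all coordinates but the \<open>k\<close>-th, as a bilinear form of \<open>L2_coin_space_upd\<close>.
\<close>

lemma L2_inner_coin_space_upd:
  assumes p: "\<And>n. 0 < p n \<and> p n < 1" and f: "f \<in> L2 (coin_space p)" and g: "g \<in> L2 (coin_space p)"
  shows "L2_inner (coin_space p) f g
    = p k * L2_inner (coin_space p) (\<lambda>\<omega>. f (\<omega> (k := 1))) (\<lambda>\<omega>. g (\<omega> (k := 1)))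
    + (1 - p k) * L2_inner (coin_space p) (\<lambda>\<omega>. f (\<omega> (k := - 1))) (\<lambda>\<omega>. g (\<omega> (k := - 1)))"
proof -
  have split: "a * x + b * y - (a * x' + b * y') = a * (x - x') + b * (y - y')"
    for a b x x' y y' :: real
    by (simp add: algebra_simps)
  have "4 * L2_inner (coin_space p) f g
    = p k * (4 * L2_inner (coin_space p) (\<lambda>\<omega>. f (\<omega> (k := 1))) (\<lambda>\<omega>. g (\<omega> (k := 1))))
    + (1 - p k) * (4 * L2_inner (coin_space p) (\<lambda>\<omega>. f (\<omega> (k := - 1))) (\<lambda>\<omega>. g (\<omega> (k := - 1))))"
    unfolding L2_inner_polarization[OF f g]
      L2_inner_polarization[OF L2_coin_space_upd(1)[OF p f, of k] L2_coin_space_upd(1)[OF p g, of k]]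
      L2_inner_polarization[OF L2_coin_space_upd(2)[OF p f, of k] L2_coin_space_upd(2)[OF p g, of k]]
      L2_coin_space_upd(3)[OF p L2_lincomb[OF f g], of 1 1 k]
      L2_coin_space_upd(3)[OF p L2_lincomb[OF f g], of 1 "-1" k]
    by (rule split)
  then show ?thesis by linarith
qed

text \<open>
  Multiplication by \<open>Z\<^sub>k\<close> is adjoint to the gradient on functions that do not depend on coordinate
  \<open>k\<close>: the two values of \<open>Z\<^sub>k\<close> are \<open>q / s\<close> and \<open>- p / s\<close> with \<open>s = \<surd>(p q)\<close>, and weighted with their
  probabilities they become \<open>s\<close> and \<open>- s\<close>. All statements on chaos coefficients below reduce to this.
\<close>

lemma L2_inner_Z_gradient:
  assumes p: "\<And>n. 0 < p n \<and> p n < 1" and f: "f \<in> L2 (coin_space p)"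
    and \<sigma>: "finite \<sigma>" "k \<in> \<sigma>"
  shows "L2_inner (coin_space p) (Z p \<sigma>) f
    = L2_inner (coin_space p) (Z p (\<sigma> - {k})) (discrete_gradient p k f)"
proof -
  let ?M = "coin_space p" and ?Z = "Z p (\<sigma> - {k})"
  define s where "s = sqrt (p k * (1 - p k))"
  have s: "0 < s" "s * s = p k * (1 - p k)" using p[of k] by (auto simp: s_def)
  have Z: "Z p \<sigma> (\<omega> (k := c)) = (c + (1 - p k) - p k) / (2 * s) * ?Z \<omega>" for \<omega> c
    unfolding Z_split[OF \<sigma>] by (simp add: Z_upd s_def)
  have int: "integrable ?M (\<lambda>\<omega>. ?Z \<omega> * f (\<omega> (k := 1)))" "integrable ?M (\<lambda>\<omega>. ?Z \<omega> * f (\<omega> (k := - 1)))"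
    by (intro L2_integrable_mult Z_L2 L2_coin_space_upd p f)+
  have c: "p k * ((1 + (1 - p k) - p k) / (2 * s)) = s"
    "(1 - p k) * ((- 1 + (1 - p k) - p k) / (2 * s)) = - s"
    using s by (simp_all add: field_simps)
  have "L2_inner ?M (Z p \<sigma>) f
      = p k * ((1 + (1 - p k) - p k) / (2 * s)) * L2_inner ?M ?Z (\<lambda>\<omega>. f (\<omega> (k := 1)))
      + (1 - p k) * ((- 1 + (1 - p k) - p k) / (2 * s)) * L2_inner ?M ?Z (\<lambda>\<omega>. f (\<omega> (k := - 1)))"
    unfolding L2_inner_coin_space_upd[OF p Z_L2[OF p] f, where k = k] Z
    by (simp add: L2_inner_def mult.assoc)
  also have "\<dots> = s * L2_inner ?M ?Z (\<lambda>\<omega>. f (\<omega> (k := 1))) - s * L2_inner ?M ?Z (\<lambda>\<omega>. f (\<omega> (k := - 1)))"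
    unfolding c by simp
  also have "\<dots> = L2_inner ?M ?Z (discrete_gradient p k f)"
  proof -
    have "L2_inner ?M ?Z (discrete_gradient p k f)
        = (\<integral>\<omega>. s * (?Z \<omega> * f (\<omega> (k := 1))) - s * (?Z \<omega> * f (\<omega> (k := - 1))) \<partial>?M)"
      unfolding L2_inner_def discrete_gradient_def s_def by (simp add: algebra_simps)
    then show ?thesis using int by (simp add: L2_inner_def)
  qed
  finally show ?thesis .
qed

text \<open>
  A common index of \<open>\<sigma>\<close> and \<open>\<tau>\<close> can be removed from both by adjointness, and an index in only one of
  them makes the inner product vanish, because the gradient kills the other factor.
\<close>

lemma Z_orthonormal:
  assumes p: "\<And>n. 0 < p n \<and> p n < 1" and "finite \<sigma>" "finite \<tau>"
  shows "L2_inner (coin_space p) (Z p \<sigma>) (Z p \<tau>) = (if \<sigma> = \<tau> then 1 else 0)"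
  using assms(2,3)
proof (induction "card \<sigma> + card \<tau>" arbitrary: \<sigma> \<tau> rule: less_induct)
  case less
  interpret prob_space "coin_space p" using p by (rule prob_space_coin_space)
  have step: "L2_inner (coin_space p) (Z p \<sigma>) (Z p \<tau>) = (if \<sigma> = \<tau> then 1 else 0)"
    if k: "k \<in> \<sigma>" and fin: "finite \<sigma>" "finite \<tau>"
      and IH: "k \<in> \<tau> \<Longrightarrow> L2_inner (coin_space p) (Z p (\<sigma> - {k})) (Z p (\<tau> - {k}))
        = (if \<sigma> - {k} = \<tau> - {k} then 1 else 0)" for k \<sigma> \<tau>
  proof -
    have "L2_inner (coin_space p) (Z p \<sigma>) (Z p \<tau>)
        = L2_inner (coin_space p) (Z p (\<sigma> - {k})) (\<lambda>\<omega>. indicator \<tau> k * Z p (\<tau> - {k}) \<omega>)"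
      unfolding L2_inner_Z_gradient[OF p Z_L2[OF p] fin(1) k]
      by (simp add: discrete_gradient_Z[OF p fin(2)] L2_inner_def)
    also have "\<dots> = (if \<sigma> = \<tau> then 1 else 0)"
    proof (cases "k \<in> \<tau>")
      case True
      have "\<sigma> - {k} = \<tau> - {k} \<longleftrightarrow> \<sigma> = \<tau>" using True k by blast
      then show ?thesis using IH[OF True] True by simp
    next
      case False
      then show ?thesis using k by (auto simp: L2_inner_def)
    qed
    finally show ?thesis .
  qed
  have smaller: "card (\<sigma> - {k}) + card (\<tau> - {k}) < card \<sigma> + card \<tau>" if "k \<in> \<sigma>" "k \<in> \<tau>" for k
    using that less.prems by (intro add_strict_mono card_Diff1_less)
  consider k where "k \<in> \<sigma>" | k where "k \<in> \<tau>" | "\<sigma> = {}" "\<tau> = {}" by blast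
  then show ?case
  proof cases
    case 1
    show ?thesis
      by (rule step[OF 1 less.prems]) (use less.hyps[OF smaller[OF 1]] less.prems in simp)
  next
    case 2
    have "L2_inner (coin_space p) (Z p \<tau>) (Z p \<sigma>) = (if \<tau> = \<sigma> then 1 else 0)"
    proof (rule step[OF 2 less.prems(2,1)])
      assume "k \<in> \<sigma>"
      from less.hyps[OF smaller[OF this 2]] less.prems
      show "L2_inner (coin_space p) (Z p (\<tau> - {k})) (Z p (\<sigma> - {k}))
        = (if \<tau> - {k} = \<sigma> - {k} then 1 else 0)"
        by (auto simp: L2_inner_commute[of _ "Z p (\<tau> - {k})"])
    qed
    then show ?thesis by (auto simp: L2_inner_commute[of _ "Z p \<sigma>"])
  next
    case 3
    then show ?thesis by (simp add: L2_inner_def Z_def prob_space)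
  qed
qed

section \<open>Totality of the chaos functions\<close>

lemma sets_coin_space_heads:
  fixes p :: "nat \<Rightarrow> real"
  defines "G \<equiv> {{\<omega> \<in> space (coin_space p). \<forall>j\<in>J. \<omega> j = 1} | J. finite J}"
  shows "sets (coin_space p) = sigma_sets (space (coin_space p)) G"
proof
  note [measurable] = borel_measurable_coordinate
  have "{\<omega> \<in> space (coin_space p). \<forall>j\<in>J. \<omega> j = 1} \<in> sets (coin_space p)" if "finite J" for J
    using that by measurable
  then show "sigma_sets (space (coin_space p)) G \<subseteq> sets (coin_space p)"
    unfolding G_def by (intro sets.sigma_sets_subset) auto
next
  let ?\<Omega> = "space (coin_space p)"
  have heads: "{\<omega> \<in> ?\<Omega>. \<omega> n = 1} \<in> sigma_sets ?\<Omega> G" for n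
    unfolding G_def by (rule sigma_sets.Basic) (auto intro!: exI[of _ "{n}"])
  have tails: "{\<omega> \<in> ?\<Omega>. \<omega> n = -1} \<in> sigma_sets ?\<Omega> G" for n
  proof -
    have "{\<omega> \<in> ?\<Omega>. \<omega> n = -1} = ?\<Omega> - {\<omega> \<in> ?\<Omega>. \<omega> n = 1}"
      by (auto simp: space_coin_space)
    then show ?thesis using heads[of n] by (auto intro: sigma_sets.Compl)
  qed
  show "sets (coin_space p) \<subseteq> sigma_sets ?\<Omega> G"
    unfolding sets_coin_space space_coin_space[symmetric, of p]
  proof (rule sigma_sets_mono, safe)
    fix n :: nat and A :: "real set" assume "A \<subseteq> {-1, 1}"
    then have "A \<in> Pow {-1, 1}" by blast
    then consider "A = {}" | "A = {-1}" | "A = {1}" | "A = {-1, 1}"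
      by (auto simp: Pow_insert)
    then show "{\<omega>. (\<forall>n. \<omega> n \<in> {-1, 1}) \<and> \<omega> n \<in> A} \<in> sigma_sets ?\<Omega> G"
    proof cases
      case 1
      then show ?thesis by (simp add: sigma_sets.Empty)
    next
      case 2
      then show ?thesis using tails[of n] by (simp add: space_coin_space)
    next
      case 3
      then show ?thesis using heads[of n] by (simp add: space_coin_space)
    next
      case 4
      then have "{\<omega>. (\<forall>n. \<omega> n \<in> {-1, 1}) \<and> \<omega> n \<in> A} = ?\<Omega>"
        by (auto simp: space_coin_space)
      then show ?thesis by (simp add: sigma_sets_top)
    qed
  qed
qed

text \<open>
  On the two-point space, \<open>1{\<omega>\<^sub>j = 1} = p\<^sub>j + s\<^sub>j Z\<^sub>j\<close> with \<open>s\<^sub>j = \<surd>(p\<^sub>j q\<^sub>j)\<close>. Events that only ask for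
  heads are preferable to general cylinders here: multiplying out the product over \<open>J\<close> meets each
  \<open>Z\<^sub>j\<close> at most once, so it yields the \<open>Z\<^sub>X\<close> with \<open>X \<subseteq> J\<close> directly.
\<close>

lemma indicator_heads_in_span_Z:
  assumes p: "\<And>n. 0 < p n \<and> p n < 1" and J: "finite J"
  shows "\<exists>g\<in>L2_span (Z p) {\<sigma>. finite \<sigma>}. \<forall>\<omega>\<in>space (coin_space p).
    g \<omega> = indicator {\<omega> \<in> space (coin_space p). \<forall>j\<in>J. \<omega> j = 1} \<omega>"
proof -
  define s where "s j = sqrt (p j * (1 - p j))" for j
  have s: "0 < s j" "s j * s j = p j * (1 - p j)" for j using p[of j] by (auto simp: s_def)
  define a where "a X = (\<Prod>j\<in>X. s j) * (\<Prod>j\<in>J - X. p j)" for X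
  let ?g = "\<lambda>\<omega>. \<Sum>X\<in>Pow J. a X * Z p X \<omega>"
  have "?g \<omega> = indicator {\<omega> \<in> space (coin_space p). \<forall>j\<in>J. \<omega> j = 1} \<omega>"
    if \<omega>: "\<omega> \<in> space (coin_space p)" for \<omega>
  proof -
    have "?g \<omega> = (\<Sum>X\<in>Pow J. (\<Prod>j\<in>X. s j * ((\<omega> j + (1 - p j) - p j) / (2 * s j))) * (\<Prod>j\<in>J - X. p j))"
      unfolding a_def Z_def s_def[symmetric] prod.distrib by (simp only: mult_ac)
    also have "\<dots> = (\<Prod>j\<in>J. s j * ((\<omega> j + (1 - p j) - p j) / (2 * s j)) + p j)"
      using J by (rule prod_add[symmetric])
    also have "\<dots> = (\<Prod>j\<in>J. (\<omega> j + 1) / 2)"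
      using s(1) by (intro prod.cong refl) (simp add: field_simps less_imp_neq[symmetric])
    also have "\<dots> = (\<Prod>j\<in>J. if \<omega> j = 1 then 1 else 0)"
    proof (rule prod.cong[OF refl])
      fix j
      have "\<omega> j = 1 \<or> \<omega> j = -1" using \<omega> by (auto simp: space_coin_space)
      then show "(\<omega> j + 1) / 2 = (if \<omega> j = 1 then 1 else 0)" by auto
    qed
    also have "\<dots> = indicator {\<omega> \<in> space (coin_space p). \<forall>j\<in>J. \<omega> j = 1} \<omega>"
    proof (cases "\<forall>j\<in>J. \<omega> j = 1")
      case False
      then obtain j where "j \<in> J" "\<omega> j \<noteq> 1" by blast
      then have "(\<Prod>j\<in>J. if \<omega> j = 1 then 1 else 0 :: real) = 0"
        using J by (intro prod_zero) auto
      then show ?thesis using False by simp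
    qed (use \<omega> in simp)
    finally show ?thesis .
  qed
  moreover have "Pow J \<subseteq> {\<sigma>. finite \<sigma>}" using J by (auto dest: finite_subset)
  then have "?g \<in> L2_span (Z p) {\<sigma>. finite \<sigma>}"
    using J unfolding L2_span_def by blast
  ultimately show ?thesis by (intro bexI[of _ ?g] ballI)
qed

lemma L2_closure_span_Z:
  assumes p: "\<And>n. 0 < p n \<and> p n < 1"
  shows "L2_closure (coin_space p) (L2_span (Z p) {\<sigma>. finite \<sigma>}) = L2 (coin_space p)"
proof -
  let ?\<Omega> = "space (coin_space p)"
  define G where "G = {{\<omega> \<in> ?\<Omega>. \<forall>j\<in>J. \<omega> j = 1} | J. finite J}"
  define S where "S = L2_span (Z p) {\<sigma>. finite \<sigma>}"
  have "L2_closure (coin_space p) S = L2 (coin_space p)"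
  proof (rule L2_closure_generator[where G = G])
    show "finite_measure (coin_space p)"
      using prob_space_coin_space[OF p] by (rule prob_space.finite_measure)
    show "sets (coin_space p) = sigma_sets ?\<Omega> G"
      unfolding G_def by (rule sets_coin_space_heads)
    show "G \<subseteq> Pow ?\<Omega>" by (auto simp: G_def)
    show "Int_stable G"
    proof (rule Int_stableI)
      fix A B assume "A \<in> G" "B \<in> G"
      then obtain J K where "finite J" "A = {\<omega> \<in> ?\<Omega>. \<forall>j\<in>J. \<omega> j = 1}"
        "finite K" "B = {\<omega> \<in> ?\<Omega>. \<forall>j\<in>K. \<omega> j = 1}" unfolding G_def by blast
      then have "A \<inter> B = {\<omega> \<in> ?\<Omega>. \<forall>j\<in>J \<union> K. \<omega> j = 1}" "finite (J \<union> K)" by auto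
      then show "A \<inter> B \<in> G" unfolding G_def by blast
    qed
    show "?\<Omega> \<in> G" unfolding G_def by (auto intro!: exI[of _ "{}"])
    show "S \<subseteq> L2 (coin_space p)"
      by (auto simp: S_def L2_span_def intro!: L2_sum Z_L2[OF p])
    show "(\<lambda>\<omega>. a * f \<omega> + b * g \<omega>) \<in> S" if "f \<in> S" "g \<in> S" for f g a b
      using that unfolding S_def by (rule L2_span_lincomb)
    show "\<exists>g\<in>S. \<forall>\<omega>\<in>?\<Omega>. g \<omega> = indicator A \<omega>" if A: "A \<in> G" for A
    proof -
      from A obtain J where J: "finite J" "A = {\<omega> \<in> ?\<Omega>. \<forall>j\<in>J. \<omega> j = 1}"
        unfolding G_def by blast
      show ?thesis unfolding J(2) S_def by (rule indicator_heads_in_span_Z[OF p J(1)])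
    qed
  qed
  then show ?thesis by (simp only: S_def)
qed

lemma Z_Parseval:
  assumes p: "\<And>n. 0 < p n \<and> p n < 1" and f: "f \<in> L2 (coin_space p)"
  shows "((\<lambda>\<sigma>. (L2_inner (coin_space p) (Z p \<sigma>) f)\<^sup>2) has_sum L2_inner (coin_space p) f f)
    {\<sigma>. finite \<sigma>}"
proof (rule L2_Parseval)
  show "Z p \<sigma> \<in> L2 (coin_space p)" for \<sigma>
    by (rule Z_L2[OF p])
  show "L2_inner (coin_space p) (Z p \<sigma>) (Z p \<tau>) = (if \<sigma> = \<tau> then 1 else 0)"
    if "\<sigma> \<in> {\<sigma>. finite \<sigma>}" "\<tau> \<in> {\<sigma>. finite \<sigma>}" for \<sigma> \<tau>
    using that by (intro Z_orthonormal[OF p]) auto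
  show "f \<in> L2_closure (coin_space p) (L2_span (Z p) {\<sigma>. finite \<sigma>})"
    unfolding L2_closure_span_Z[OF p] by (rule f)
qed

section \<open>The energy form in terms of the gradient\<close>

text \<open>
  Both operators are bounded and linear and agree on the span of the \<open>Z\<^sub>\<sigma>\<close>, which is dense. If \<open>g\<close> is
  in the span, then \<open>T f - D f = T (f - g) - D (f - g)\<close> almost surely, and the norm of the
  right-hand side is at most a fixed multiple of \<open>\<parallel>f - g\<parallel>\<close>.
\<close>

lemma annihilation_eq_gradient:
  assumes p: "\<And>n. 0 < p n \<and> p n < 1" and T: "is_annihilation p k T" and f: "f \<in> L2 (coin_space p)"
  shows "AE \<omega> in coin_space p. T f \<omega> = discrete_gradient p k f \<omega>"
proof -
  let ?M = "coin_space p" and ?D = "discrete_gradient p k" and ?S = "L2_span (Z p) {\<sigma>. finite \<sigma>}"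
  have TL: "T g \<in> L2 ?M" if "g \<in> L2 ?M" for g
    using T that by (simp add: is_annihilation_def bounded_linear_L2_def)
  have Tlin: "AE \<omega> in ?M. T (\<lambda>\<omega>. a * g \<omega> + b * h \<omega>) \<omega> = a * T g \<omega> + b * T h \<omega>"
    if "g \<in> L2 ?M" "h \<in> L2 ?M" for g h a b
    using T that by (simp add: is_annihilation_def bounded_linear_L2_def)
  have TZ: "AE \<omega> in ?M. T (Z p \<sigma>) \<omega> = ?D (Z p \<sigma>) \<omega>" if "finite \<sigma>" for \<sigma>
    using T that by (simp add: is_annihilation_def discrete_gradient_Z[OF p])
  obtain B where B: "\<And>g. g \<in> L2 ?M \<Longrightarrow> L2_norm ?M (T g) \<le> B * L2_norm ?M g"
    using T unfolding is_annihilation_def bounded_linear_L2_def by blast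
  have T2: "(\<integral>\<omega>. (T g \<omega>)\<^sup>2 \<partial>?M) \<le> B\<^sup>2 * (\<integral>\<omega>. (g \<omega>)\<^sup>2 \<partial>?M)" if g: "g \<in> L2 ?M" for g
  proof -
    have "0 \<le> L2_norm ?M (T g)"
      by (simp add: L2_norm_def L2_inner_def)
    then have "(L2_norm ?M (T g))\<^sup>2 \<le> (B * L2_norm ?M g)\<^sup>2"
      using B[OF g] by (rule power_mono[rotated])
    moreover have "(L2_norm ?M h)\<^sup>2 = (\<integral>\<omega>. (h \<omega>)\<^sup>2 \<partial>?M)" for h
      by (simp add: L2_norm_def L2_inner_def power2_eq_square)
    ultimately show ?thesis by (simp add: power_mult_distrib)
  qed
  have span: "g \<in> L2 ?M \<and> (AE \<omega> in ?M. T g \<omega> = ?D g \<omega>)" if gS: "g \<in> ?S" for g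
  proof -
    obtain F a where g: "g = (\<lambda>\<omega>. \<Sum>\<sigma>\<in>F. a \<sigma> * Z p \<sigma> \<omega>)" and F: "finite F" "F \<subseteq> {\<sigma>. finite \<sigma>}"
      using gS unfolding L2_span_def by blast
    have gL: "(\<lambda>\<omega>. \<Sum>\<sigma>\<in>F. a \<sigma> * Z p \<sigma> \<omega>) \<in> L2 ?M" for F
      by (intro L2_sum Z_L2 p)
    have "AE \<omega> in ?M. T (\<lambda>\<omega>. \<Sum>\<sigma>\<in>F. a \<sigma> * Z p \<sigma> \<omega>) \<omega> = ?D (\<lambda>\<omega>. \<Sum>\<sigma>\<in>F. a \<sigma> * Z p \<sigma> \<omega>) \<omega>"
      using F
    proof (induction F)
      case empty
      \<comment> \<open>Linearity gives \<open>T 0 = 0\<close>, with the zero function written as \<open>0 * Z p {} + 0 * Z p {}\<close>.\<close>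
      show ?case
        using Tlin[OF Z_L2[OF p] Z_L2[OF p], of 0 "{}" 0 "{}"]
        by (simp add: discrete_gradient_def)
    next
      case (insert \<tau> F)
      let ?g = "\<lambda>\<omega>. \<Sum>\<sigma>\<in>F. a \<sigma> * Z p \<sigma> \<omega>"
      have eq: "(\<lambda>\<omega>. \<Sum>\<sigma>\<in>insert \<tau> F. a \<sigma> * Z p \<sigma> \<omega>) = (\<lambda>\<omega>. a \<tau> * Z p \<tau> \<omega> + 1 * ?g \<omega>)"
        using insert.hyps by simp
      have IH: "AE \<omega> in ?M. T ?g \<omega> = ?D ?g \<omega>"
        using insert by auto
      have "finite \<tau>" using insert.prems by simp
      show ?case
        using Tlin[OF Z_L2[OF p] gL, of "a \<tau>" \<tau> 1 F] TZ[OF \<open>finite \<tau>\<close>] IH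
        unfolding eq discrete_gradient_lincomb by eventually_elim simp
    qed
    then show ?thesis unfolding g using gL by simp
  qed
  have small: "L2_dist2 ?M (T f) (?D f) \<le> (2 * B\<^sup>2 + 2) * L2_dist2 ?M f g" if g: "g \<in> ?S" for g
  proof -
    have gL: "g \<in> L2 ?M" and Tg: "AE \<omega> in ?M. T g \<omega> = ?D g \<omega>" using span[OF g] by auto
    let ?h = "\<lambda>\<omega>. f \<omega> - g \<omega>"
    have h: "?h \<in> L2 ?M" by (rule L2_diff[OF f gL])
    have Th: "AE \<omega> in ?M. T ?h \<omega> = T f \<omega> - T g \<omega>"
      using Tlin[OF f gL, of 1 "-1"] by simp
    have Dh: "?D ?h \<omega> = ?D f \<omega> - ?D g \<omega>" for \<omega>
      using discrete_gradient_lincomb[of p k 1 f "-1" g] by simp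
    have "L2_dist2 ?M (T f) (?D f) = L2_dist2 ?M (T ?h) (?D ?h)"
      unfolding L2_dist2_def
    proof (rule integral_cong_AE)
      note [measurable] = L2_measurable[OF TL[OF f]] L2_measurable[OF TL[OF h]]
        L2_measurable[OF discrete_gradient_L2[OF p f]] L2_measurable[OF discrete_gradient_L2[OF p h]]
      show "(\<lambda>\<omega>. (T f \<omega> - ?D f \<omega>)\<^sup>2) \<in> borel_measurable ?M"
        "(\<lambda>\<omega>. (T ?h \<omega> - ?D ?h \<omega>)\<^sup>2) \<in> borel_measurable ?M" by measurable
      show "AE \<omega> in ?M. (T f \<omega> - ?D f \<omega>)\<^sup>2 = (T ?h \<omega> - ?D ?h \<omega>)\<^sup>2"
        using Th Tg by eventually_elim (simp add: Dh)
    qed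
    also have "\<dots> \<le> 2 * L2_dist2 ?M (T ?h) (\<lambda>\<omega>. 0) + 2 * L2_dist2 ?M (\<lambda>\<omega>. 0) (?D ?h)"
      by (rule L2_dist2_triangle) (use TL[OF h] discrete_gradient_L2[OF p h] in \<open>auto simp: L2_def\<close>)
    also have "\<dots> \<le> 2 * (B\<^sup>2 * L2_dist2 ?M f g) + 2 * L2_dist2 ?M f g"
      using T2[OF h] discrete_gradient_contractive[OF p h, of k]
      by (simp add: L2_dist2_def)
    finally show ?thesis by (simp add: algebra_simps)
  qed
  have "L2_dist2 ?M (T f) (?D f) \<le> 0"
  proof (rule field_le_epsilon)
    fix \<epsilon> :: real assume "0 < \<epsilon>"
    have K: "0 < 2 * B\<^sup>2 + 2" by (simp add: add_nonneg_pos)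
    then have "0 < \<epsilon> / (2 * B\<^sup>2 + 2)" using \<open>0 < \<epsilon>\<close> by simp
    moreover have "f \<in> L2_closure ?M ?S" using f L2_closure_span_Z[OF p] by simp
    ultimately obtain g where g: "g \<in> ?S" "L2_dist2 ?M f g < \<epsilon> / (2 * B\<^sup>2 + 2)"
      unfolding L2_closure_def by blast
    then show "L2_dist2 ?M (T f) (?D f) \<le> 0 + \<epsilon>"
      using small[OF g(1)] K by (simp add: pos_less_divide_eq mult.commute)
  qed
  then have "(\<integral>\<omega>. (T f \<omega> - ?D f \<omega>)\<^sup>2 \<partial>?M) = 0"
    using L2_dist2_nonneg[of ?M "T f" "?D f"] unfolding L2_dist2_def by linarith
  moreover have "integrable ?M (\<lambda>\<omega>. (T f \<omega> - ?D f \<omega>)\<^sup>2)"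
    by (intro integrable_L2_dist2 TL f discrete_gradient_L2 p)
  ultimately have "AE \<omega> in ?M. (T f \<omega> - ?D f \<omega>)\<^sup>2 = 0"
    using integral_nonneg_eq_0_iff_AE[of ?M "\<lambda>\<omega>. (T f \<omega> - ?D f \<omega>)\<^sup>2"] by auto
  then show ?thesis by eventually_elim simp
qed

lemma energy_form_eq_gradient:
  assumes p: "\<And>n. 0 < p n \<and> p n < 1" and f: "f \<in> L2 (coin_space p)"
  shows "energy_form p w f f
    = (\<Sum>k. w k * (\<integral>\<omega>. (discrete_gradient p k f \<omega>)\<^sup>2 \<partial>coin_space p))"
proof -
  have "L2_inner (coin_space p) (annihilation p k f) (annihilation p k f)
      = (\<integral>\<omega>. (discrete_gradient p k f \<omega>)\<^sup>2 \<partial>coin_space p)" for k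
  proof -
    have A: "is_annihilation p k (annihilation p k)"
      unfolding annihilation_def by (rule someI_ex[OF ex_is_annihilation[OF p]])
    then have "annihilation p k f \<in> L2 (coin_space p)"
      using f by (simp add: is_annihilation_def bounded_linear_L2_def)
    note [measurable] = L2_measurable[OF this] L2_measurable[OF discrete_gradient_L2[OF p f]]
    show ?thesis
      unfolding L2_inner_def
    proof (rule integral_cong_AE)
      show "AE \<omega> in coin_space p. annihilation p k f \<omega> * annihilation p k f \<omega>
          = (discrete_gradient p k f \<omega>)\<^sup>2"
        using annihilation_eq_gradient[OF p A f]
        by eventually_elim (simp add: power2_eq_square)
    qed measurable
  qed
  then show ?thesis by (simp add: energy_form_def)
qed

text \<open>
  The gradient shifts the coefficients: \<open>\<langle>Z\<^sub>\<tau>, D\<^sub>k f\<rangle>\<close> is the coefficient of \<open>f\<close> at \<open>\<tau> \<union> {k}\<close> when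
  \<open>k \<notin> \<tau>\<close>, and it vanishes when \<open>k \<in> \<tau>\<close>, since applying the gradient in direction \<open>k\<close> twice gives zero.
  Parseval's equation is therefore reindexed along \<open>\<sigma> = \<tau> \<union> {k}\<close>.
\<close>

lemma gradient_Parseval:
  assumes p: "\<And>n. 0 < p n \<and> p n < 1" and f: "f \<in> L2 (coin_space p)"
  shows "((\<lambda>\<sigma>. indicator \<sigma> k * (L2_inner (coin_space p) (Z p \<sigma>) f)\<^sup>2)
    has_sum (\<integral>\<omega>. (discrete_gradient p k f \<omega>)\<^sup>2 \<partial>coin_space p)) {\<sigma>. finite \<sigma>}"
proof -
  let ?M = "coin_space p" and ?D = "discrete_gradient p k f"
  have D: "?D \<in> L2 ?M" by (rule discrete_gradient_L2[OF p f])
  have zero: "L2_inner ?M (Z p \<tau>) ?D = 0" if "finite \<tau>" "k \<in> \<tau>" for \<tau>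
  proof -
    have "discrete_gradient p k ?D = (\<lambda>\<omega>. 0)"
      by (simp add: discrete_gradient_def fun_eq_iff)
    then show ?thesis
      using L2_inner_Z_gradient[OF p D that] by (simp add: L2_inner_def)
  qed
  have "((\<lambda>\<tau>. (L2_inner ?M (Z p \<tau>) ?D)\<^sup>2) has_sum L2_inner ?M ?D ?D) {\<tau>. finite \<tau>}"
    by (rule Z_Parseval[OF p D])
  also have "?this \<longleftrightarrow> ((\<lambda>\<tau>. (L2_inner ?M (Z p \<tau>) ?D)\<^sup>2) has_sum L2_inner ?M ?D ?D)
      {\<tau>. finite \<tau> \<and> k \<notin> \<tau>}"
    by (rule has_sum_cong_neutral) (use zero in auto)
  also have "\<dots> \<longleftrightarrow> ((\<lambda>\<sigma>. (L2_inner ?M (Z p \<sigma>) f)\<^sup>2) has_sum L2_inner ?M ?D ?D)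
      {\<sigma>. finite \<sigma> \<and> k \<in> \<sigma>}"
    by (rule has_sum_reindex_bij_witness[of _ "\<lambda>\<sigma>. \<sigma> - {k}" "insert k"])
      (auto simp: L2_inner_Z_gradient[OF p f, of _ k])
  also have "\<dots> \<longleftrightarrow> ((\<lambda>\<sigma>. indicator \<sigma> k * (L2_inner ?M (Z p \<sigma>) f)\<^sup>2)
      has_sum L2_inner ?M ?D ?D) {\<sigma>. finite \<sigma>}"
    by (rule has_sum_cong_neutral) auto
  finally show ?thesis by (simp add: L2_inner_def power2_eq_square)
qed

lemma summable_on_Times_nonneg_iff:
  fixes h :: "'a \<Rightarrow> 'b \<Rightarrow> real"
  assumes nonneg: "\<And>x y. 0 \<le> h x y" and row: "\<And>x. x \<in> A \<Longrightarrow> h x summable_on B"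
  shows "(\<lambda>(x, y). h x y) summable_on (A \<times> B) \<longleftrightarrow> (\<lambda>x. infsum (h x) B) summable_on A"
proof -
  have norm: "norm (h x y) = h x y" "norm (infsum (h x) B) = infsum (h x) B" for x y
    using nonneg by (simp_all add: infsum_nonneg)
  have "(\<lambda>(x, y). h x y) summable_on (A \<times> B)
      \<longleftrightarrow> (\<lambda>z. norm (case z of (x, y) \<Rightarrow> h x y)) summable_on (A \<times> B)"
    by (rule summable_on_iff_abs_summable_on_real)
  also have "\<dots> \<longleftrightarrow> (\<forall>x\<in>A. h x summable_on B) \<and> (\<lambda>x. infsum (h x) B) summable_on A"
    using Infinite_Sum.abs_summable_on_Sigma_iff[where f = "\<lambda>(x, y). h x y" and A = A and B = "\<lambda>_. B"]
    by (simp only: prod.case norm)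
  finally show ?thesis using row by blast
qed

text \<open>
  The terms \<open>w(k) 1\<^sub>\<sigma>(k) \<langle>Z\<^sub>\<sigma>, f\<rangle>\<^sup>2\<close> are nonnegative, so they may be summed first over \<open>k\<close> or first over
  \<open>\<sigma>\<close>. The former order gives the series defining the domain, the latter the energy series.
\<close>

lemma energy_domain_iff_gradient:
  assumes p: "\<And>n. 0 < p n \<and> p n < 1" and w: "\<And>n. 0 \<le> w n" and f: "f \<in> L2 (coin_space p)"
  shows "f \<in> energy_domain p w
    \<longleftrightarrow> summable (\<lambda>k. w k * (\<integral>\<omega>. (discrete_gradient p k f \<omega>)\<^sup>2 \<partial>coin_space p))"
proof -
  let ?c = "\<lambda>\<sigma>. (L2_inner (coin_space p) (Z p \<sigma>) f)\<^sup>2"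
  let ?\<Gamma> = "{\<sigma>::nat set. finite \<sigma>}"
  define h where "h \<sigma> k = w k * (indicator \<sigma> k * ?c \<sigma>)" for \<sigma> k
  have h0: "0 \<le> h \<sigma> k" for \<sigma> k using w by (simp add: h_def)
  have row: "(h \<sigma> has_sum (weight_count w \<sigma> * ?c \<sigma>)) UNIV" if "finite \<sigma>" for \<sigma>
  proof -
    have "(h \<sigma> has_sum (weight_count w \<sigma> * ?c \<sigma>)) \<sigma>"
      using that by (simp add: has_sum_finite_iff h_def weight_count_def sum_distrib_right)
    then show ?thesis
      by (subst has_sum_cong_neutral[where S = \<sigma> and g = "h \<sigma>", symmetric]) (auto simp: h_def)
  qed
  have col: "((\<lambda>\<sigma>. h \<sigma> k) has_sum (w k * (\<integral>\<omega>. (discrete_gradient p k f \<omega>)\<^sup>2 \<partial>coin_space p))) ?\<Gamma>" for k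
    unfolding h_def by (intro has_sum_cmult_right gradient_Parseval p f)
  have "f \<in> energy_domain p w \<longleftrightarrow> (\<lambda>\<sigma>. weight_count w \<sigma> * ?c \<sigma>) summable_on ?\<Gamma>"
    using f by (simp add: energy_domain_def)
  also have "\<dots> \<longleftrightarrow> (\<lambda>\<sigma>. infsum (h \<sigma>) UNIV) summable_on ?\<Gamma>"
    by (rule summable_on_cong) (simp add: infsumI[OF row])
  also have "\<dots> \<longleftrightarrow> (\<lambda>(\<sigma>, k). h \<sigma> k) summable_on (?\<Gamma> \<times> UNIV)"
    by (rule summable_on_Times_nonneg_iff[symmetric])
      (use h0 row in \<open>auto intro: has_sum_imp_summable\<close>)
  also have "\<dots> \<longleftrightarrow> (\<lambda>(k, \<sigma>). h \<sigma> k) summable_on (UNIV \<times> ?\<Gamma>)"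
    by (subst summable_on_swap) simp
  also have "\<dots> \<longleftrightarrow> (\<lambda>k. infsum (\<lambda>\<sigma>. h \<sigma> k) ?\<Gamma>) summable_on UNIV"
    by (rule summable_on_Times_nonneg_iff) (use h0 col in \<open>auto intro: has_sum_imp_summable\<close>)
  also have "\<dots> \<longleftrightarrow> summable (\<lambda>k. w k * (\<integral>\<omega>. (discrete_gradient p k f \<omega>)\<^sup>2 \<partial>coin_space p))"
    using w by (subst summable_on_UNIV_nonneg_real_iff) (auto simp: infsumI[OF col])
  finally show ?thesis .
qed

section \<open>The contraction property\<close>

lemma contraction_comp_L2:
  assumes C: "contraction_function C" and f: "f \<in> L2 M"
  shows "C \<circ> f \<in> L2 M"
proof -
  have lip: "\<bar>C s - C t\<bar> \<le> \<bar>s - t\<bar>" and C0: "C 0 = 0" for s t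
    using C by (auto simp: contraction_function_def)
  have "1-lipschitz_on UNIV C"
    by (rule lipschitz_onI) (use lip in \<open>simp_all add: dist_real_def\<close>)
  then have "C \<in> borel_measurable borel"
    by (intro borel_measurable_continuous_onI lipschitz_on_continuous_on)
  then have m: "C \<circ> f \<in> borel_measurable M"
    using measurable_comp[OF L2_measurable[OF f]] by blast
  have "integrable M (\<lambda>x. (f x)\<^sup>2)" using f by (simp add: L2_def)
  then have "integrable M (\<lambda>x. ((C \<circ> f) x)\<^sup>2)"
  proof (rule Bochner_Integration.integrable_bound)
    show "AE x in M. norm (((C \<circ> f) x)\<^sup>2) \<le> norm ((f x)\<^sup>2)"
      using lip[of _ 0] C0 by (intro AE_I2) (simp add: abs_le_square_iff[symmetric])
  qed (use m in measurable)
  then show ?thesis using m by (simp add: L2_def)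
qed

lemma gradient_contraction_comp:
  assumes p: "\<And>n. 0 < p n \<and> p n < 1" and C: "contraction_function C" and f: "f \<in> L2 (coin_space p)"
  shows "(\<integral>\<omega>. (discrete_gradient p k (C \<circ> f) \<omega>)\<^sup>2 \<partial>coin_space p)
    \<le> (\<integral>\<omega>. (discrete_gradient p k f \<omega>)\<^sup>2 \<partial>coin_space p)"
proof (rule integral_mono)
  show "integrable (coin_space p) (\<lambda>\<omega>. (discrete_gradient p k (C \<circ> f) \<omega>)\<^sup>2)"
    "integrable (coin_space p) (\<lambda>\<omega>. (discrete_gradient p k f \<omega>)\<^sup>2)"
    using discrete_gradient_L2[OF p f] discrete_gradient_L2[OF p contraction_comp_L2[OF C f]]
    by (simp_all add: L2_def)
  fix \<omega>
  have "\<bar>C (f (\<omega> (k := 1))) - C (f (\<omega> (k := - 1)))\<bar> \<le> \<bar>f (\<omega> (k := 1)) - f (\<omega> (k := - 1))\<bar>"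
    using C by (simp add: contraction_function_def)
  then have "\<bar>discrete_gradient p k (C \<circ> f) \<omega>\<bar> \<le> \<bar>discrete_gradient p k f \<omega>\<bar>"
    unfolding discrete_gradient_def abs_mult by (simp add: mult_left_mono)
  then show "(discrete_gradient p k (C \<circ> f) \<omega>)\<^sup>2 \<le> (discrete_gradient p k f \<omega>)\<^sup>2"
    by (simp only: abs_le_square_iff)
qed

theorem theorem4p4:
  fixes p w :: "nat \<Rightarrow> real"
  assumes "\<And>n. 0 < p n \<and> p n < 1"
    and "\<And>n. 0 \<le> w n"
  shows "\<forall>C. contraction_function C \<longrightarrow>
    (\<forall>\<xi>\<in>energy_domain p w.
      C \<circ> \<xi> \<in> energy_domain p w \<and>
      energy_form p w (C \<circ> \<xi>) (C \<circ> \<xi>) \<le> energy_form p w \<xi> \<xi>)"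
proof (intro allI impI ballI)
  fix C \<xi> assume C: "contraction_function C" and \<xi>: "\<xi> \<in> energy_domain p w"
  note p = assms(1) and w = assms(2)
  let ?a = "\<lambda>f k. w k * (\<integral>\<omega>. (discrete_gradient p k f \<omega>)\<^sup>2 \<partial>coin_space p)"
  have L: "\<xi> \<in> L2 (coin_space p)" using \<xi> by (simp add: energy_domain_def)
  have CL: "C \<circ> \<xi> \<in> L2 (coin_space p)" by (rule contraction_comp_L2[OF C L])
  have le: "?a (C \<circ> \<xi>) k \<le> ?a \<xi> k" for k
    by (intro mult_left_mono gradient_contraction_comp p C L w)
  have nonneg: "0 \<le> ?a (C \<circ> \<xi>) k" for k
    using w by simp
  have sum: "summable (?a \<xi>)"
    using \<xi> energy_domain_iff_gradient[where w = w, OF p w L] by blast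
  have sumC: "summable (?a (C \<circ> \<xi>))"
    by (rule summable_comparison_test'[OF sum, of 0]) (use le nonneg in simp)
  have "energy_form p w (C \<circ> \<xi>) (C \<circ> \<xi>) \<le> energy_form p w \<xi> \<xi>"
    unfolding energy_form_eq_gradient[OF p L] energy_form_eq_gradient[OF p CL]
    by (intro suminf_le le sumC sum)
  then show "C \<circ> \<xi> \<in> energy_domain p w \<and>
      energy_form p w (C \<circ> \<xi>) (C \<circ> \<xi>) \<le> energy_form p w \<xi> \<xi>"
    using sumC energy_domain_iff_gradient[where w = w, OF p w CL] by blast
qed

end
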